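(* There exist absolute constants $C,c>0$ such that the following holds. Let $d\ge1$ be an integer, $\varepsilon\in(0,1]$, $\bm\ell=(\ell_1,\dots,\ell_n)\in\mathbb{Z}_+^n$, and $s\ge c\log(d/\|\bm\ell\|_\infty)$. If \[ \frac{\|\bm\ell\|_1}{\sqrt{\|\bm\ell\|_\infty}}\;\ge\; C\cdot\frac{d}{\varepsilon^2}, \] then there exists a protocol $\Pi$ for distributed Gaussian mean testing in dimension $d$ with threshold $\varepsilon$, with $n$ users sharing $s$ bits of public randomness, where user $k$ holds one sample and can send $\ell_k$ bits to the referee, such that $\delta(\Pi)\le 1/10$.
   Context: Distributed Gaussian mean testing. Let $\mathcal{G}(\bm{\mu},\mathbb{I}_d)$ denote the $d$-dimensional Gaussian with mean $\bm{\mu}\in\mathbb{R}^d$ and identity covariance. For a threshold $\varepsilon\in(0,1]$, let $\mathcal{H}_0=\{\mathcal{G}(\bm 0,\mathbb{I}_d)\}$ and $\mathcal{H}_1=\{\mathcal{G}(\bm\mu,\mathbb{I}_d):\|\bm\mu\|_2\ge\varepsilon\}$. There are $n$ users and a referee; an unknown $G\in\mathcal{H}_0\cup\mathcal{H}_1$ is fixed. User $k\in[n]$ observes $m_k\ge1$ i.i.d. samples $X^{(k)}=(\bm X^{(k,1)},\dots,\bm X^{(k,m_k)})$ from $G$ (independent across users) and sends the message $\bm Y^{(k)}=W^{(k)}(X^{(k)})\in\{0,1\}^{\ell_k}$, where the encoding functions $W^{(k)}:\mathbb{R}^{d m_k}\to\{0,1\}^{\ell_k}$ may be randomized using $s\ge0$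 uniformly random bits shared by all users (public randomness, used to jointly sample the tuple $(W^{(1)},\dots,W^{(n)})$) together with arbitrary private randomness independent across users. The referee applies a test $T:\{0,1\}^{\ell_1}\times\cdots\times\{0,1\}^{\ell_n}\to\{0,1\}$ to $(\bm Y^{(1)},\dots,\bm Y^{(n)})$ and accepts $\mathcal{H}_0$ iff the output is $0$. For the protocol $\Pi=((W^{(k)})_k,T)$, the error is $\delta(\Pi)=\max\left(\sup_{G\in\mathcal{H}_0}\Pr[T=1],\ \sup_{G\in\mathcal{H}_1}\Pr[T=0]\right)$. Here all $m_k=1$; $\|\bm\ell\|_1=\sum_k\ell_k$, $\|\bm\ell\|_\infty=\max_k\ell_k$.
   Formalization: The formal theorem adds ‖ℓ‖_∞ ≤ d (no message longer than d bits). Without it the claim is false: for d = n = 1, ε = 1, s = 0 and very large ℓ_1 the budget condition holds, but one sample cannot distinguish N(0,1) from N(1,1) with error 1/10. *)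

theory Defs
  imports "HOL-Probability.Probability"
begin

text \<open>Vectors of dimension \<open>d\<close> are functions \<open>nat \<Rightarrow> real\<close> read on the coordinates \<open>{..<d}\<close>,
  because the constants in the theorem must not depend on \<open>d\<close>. The Euclidean norm is
  \<open>L2_set _ {..<d}\<close>, and Lebesgue measure is the \<open>d\<close>-fold product of \<open>lborel\<close>.\<close>

definition gaussian :: "nat \<Rightarrow> (nat \<Rightarrow> real) \<Rightarrow> (nat \<Rightarrow> real) measure" where
  "gaussian d \<mu> = density (PiM {..<d} (\<lambda>_. lborel))
     (\<lambda>x. ennreal (exp (- (\<Sum>i<d. (x i - \<mu> i)\<^sup>2) / 2) / sqrt (2 * pi) ^ d))"

definition null_hyp :: "nat \<Rightarrow> (nat \<Rightarrow> real) measure set" where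
  "null_hyp d = {gaussian d (\<lambda>_. 0)}"

definition alt_hyp :: "nat \<Rightarrow> real \<Rightarrow> (nat \<Rightarrow> real) measure set" where
  "alt_hyp d \<epsilon> = {gaussian d \<mu> | \<mu>. L2_set \<mu> {..<d} \<ge> \<epsilon>}"

text \<open>User \<open>k\<close> applies \<open>encoder k\<close> to the public random bits, a private random seed drawn from
  \<open>private_seed k\<close>, and its sample. Messages are bit strings. The referee's test sees the messages
  only, and the value \<open>True\<close> stands for output 1, that is, for rejecting the null hypothesis.\<close>

record protocol =
  private_seed :: "nat \<Rightarrow> real measure"
  encoder :: "nat \<Rightarrow> bool list \<Rightarrow> real \<Rightarrow> (nat \<Rightarrow> real) \<Rightarrow> bool list"
  test :: "(nat \<Rightarrow> bool list) \<Rightarrow> bool"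

definition is_protocol :: "nat \<Rightarrow> nat \<Rightarrow> nat \<Rightarrow> (nat \<Rightarrow> nat) \<Rightarrow> protocol \<Rightarrow> bool" where
  "is_protocol d n s l P \<longleftrightarrow>
     (\<forall>k<n. prob_space (private_seed P k) \<and>
       (\<forall>r. length r = s \<longrightarrow>
          (\<lambda>(u, x). encoder P k r u x)
            \<in> measurable (private_seed P k \<Otimes>\<^sub>M PiM {..<d} (\<lambda>_. borel))
                          (count_space {y. length y = l k})))"

text \<open>An outcome \<open>(r, u, x)\<close> consists of the \<open>s\<close> public bits, the private seeds of the \<open>n\<close> users
  and their samples, one each, all independent. The public bits use a measure whose space is
  exactly the strings of length \<open>s\<close>, so that the events below are measurable although encoders
  are unconstrained on other strings.\<close>

definition outcome_space ::
  "nat \<Rightarrow> nat \<Rightarrow> protocol \<Rightarrow> (nat \<Rightarrow> real) measure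
     \<Rightarrow> (bool list \<times> (nat \<Rightarrow> real) \<times> (nat \<Rightarrow> nat \<Rightarrow> real)) measure" where
  "outcome_space n s P G =
     uniform_count_measure {r. length r = s}
       \<Otimes>\<^sub>M (PiM {..<n} (private_seed P) \<Otimes>\<^sub>M PiM {..<n} (\<lambda>_. G))"

definition messages ::
  "nat \<Rightarrow> protocol \<Rightarrow> bool list \<times> (nat \<Rightarrow> real) \<times> (nat \<Rightarrow> nat \<Rightarrow> real) \<Rightarrow> nat \<Rightarrow> bool list" where
  "messages n P = (\<lambda>(r, u, x). \<lambda>k\<in>{..<n}. encoder P k r (u k) (x k))"

definition output_prob :: "nat \<Rightarrow> nat \<Rightarrow> protocol \<Rightarrow> (nat \<Rightarrow> real) measure \<Rightarrow> bool \<Rightarrow> real" where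
  "output_prob n s P G b =
     measure (outcome_space n s P G)
       {\<omega> \<in> space (outcome_space n s P G). test P (messages n P \<omega>) = b}"

definition test_error :: "nat \<Rightarrow> real \<Rightarrow> nat \<Rightarrow> nat \<Rightarrow> protocol \<Rightarrow> real" where
  "test_error d \<epsilon> n s P =
     max (SUP G \<in> null_hyp d. output_prob n s P G True)
         (SUP G \<in> alt_hyp d \<epsilon>. output_prob n s P G False)"

definition l1_norm :: "nat \<Rightarrow> (nat \<Rightarrow> nat) \<Rightarrow> nat" where
  "l1_norm n l = (\<Sum>k<n. l k)"

text \<open>The theorem takes \<open>linf_norm n l \<le> d\<close>. Without it the claim fails: for \<open>n = d = 1\<close> and one
  very long message the budget condition holds, yet a single sample of \<open>N(0, 1)\<close> or \<open>N(1, 1)\<close>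
  cannot be classified with error \<open>1 / 10\<close>.\<close>

definition linf_norm :: "nat \<Rightarrow> (nat \<Rightarrow> nat) \<Rightarrow> nat" where
  "linf_norm n l = Max (l ` {..<n})"

lemma sets_gaussian [simp, measurable_cong]:
  "sets (gaussian d \<mu>) = sets (PiM {..<d} (\<lambda>_. borel :: real measure))"
  unfolding gaussian_def by (simp cong: sets_PiM_cong)

lemma prob_space_unit_variance_normal: "prob_space (density lborel (\<lambda>y. ennreal (normal_density m 1 y)))"
  by (rule prob_space_normal_density) simp

lemma gaussian_eq_PiM:
  "gaussian d \<mu> = PiM {..<d} (\<lambda>i. density lborel (\<lambda>y. ennreal (normal_density (\<mu> i) 1 y)))"
proof -
  let ?N = "\<lambda>i. density lborel (\<lambda>y. ennreal (normal_density (\<mu> i) 1 y))"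
  interpret L: product_sigma_finite "\<lambda>_::nat. lborel :: real measure" ..
  interpret N: product_prob_space ?N
    by (rule product_prob_spaceI) (rule prob_space_unit_variance_normal)
  have dens: "ennreal (exp (- (\<Sum>i<d. (x i - \<mu> i)\<^sup>2) / 2) / sqrt (2 * pi) ^ d)
      = (\<Prod>i<d. ennreal (normal_density (\<mu> i) 1 (x i)))" for x :: "nat \<Rightarrow> real"
  proof -
    have "exp (- (\<Sum>i<d. (x i - \<mu> i)\<^sup>2) / 2) = (\<Prod>i<d. exp (- (x i - \<mu> i)\<^sup>2 / 2))"
      by (simp add: exp_sum[symmetric] sum_divide_distrib sum_negf)
    then show ?thesis
      by (simp add: prod_ennreal normal_density_def prod_dividef)
  qed
  show ?thesis
  proof (rule N.PiM_eqI)
    show "sets (gaussian d \<mu>) = sets (PiM {..<d} ?N)"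
      by (simp cong: sets_PiM_cong)
    fix A assume A: "\<And>i. i \<in> {..<d} \<Longrightarrow> A i \<in> sets (?N i)"
    then have [measurable]: "A i \<in> sets borel" if "i < d" for i
      using that by simp
    have PA: "Pi\<^sub>E {..<d} A \<in> sets (PiM {..<d} (\<lambda>_. lborel :: real measure))"
      by (intro sets_PiM_I_finite) auto
    have "emeasure (gaussian d \<mu>) (Pi\<^sub>E {..<d} A)
        = (\<integral>\<^sup>+x. (\<Prod>i<d. ennreal (normal_density (\<mu> i) 1 (x i))) * indicator (Pi\<^sub>E {..<d} A) x
            \<partial>PiM {..<d} (\<lambda>_. lborel))"
      unfolding gaussian_def dens by (rule emeasure_density[OF _ PA]) measurable
    also have "\<dots> = (\<integral>\<^sup>+x. (\<Prod>i<d. ennreal (normal_density (\<mu> i) 1 (x i)) * indicator (A i) (x i))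
            \<partial>PiM {..<d} (\<lambda>_. lborel))"
    proof (intro nn_integral_cong)
      fix x :: "nat \<Rightarrow> real" assume "x \<in> space (PiM {..<d} (\<lambda>_. lborel))"
      then have x: "x \<in> extensional {..<d}" by (simp add: space_PiM PiE_def)
      have "indicator (Pi\<^sub>E {..<d} A) x = (\<Prod>i<d. indicator (A i) (x i) :: ennreal)"
        using x by (auto simp: indicator_def PiE_def Pi_def)
      then show "(\<Prod>i<d. ennreal (normal_density (\<mu> i) 1 (x i))) * indicator (Pi\<^sub>E {..<d} A) x
          = (\<Prod>i<d. ennreal (normal_density (\<mu> i) 1 (x i)) * indicator (A i) (x i))"
        by (simp add: prod.distrib)
    qed
    also have "\<dots> = (\<Prod>i<d. \<integral>\<^sup>+y. ennreal (normal_density (\<mu> i) 1 y) * indicator (A i) y \<partial>lborel)"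
      by (rule L.product_nn_integral_prod) auto
    also have "\<dots> = (\<Prod>i<d. emeasure (?N i) (A i))"
      by (intro prod.cong refl) (simp add: emeasure_density)
    finally show "emeasure (gaussian d \<mu>) (Pi\<^sub>E {..<d} A) = (\<Prod>i<d. emeasure (?N i) (A i))" .
  qed simp
qed

lemma prob_space_gaussian: "prob_space (gaussian d \<mu>)"
  unfolding gaussian_eq_PiM by (intro prob_space_PiM prob_space_unit_variance_normal)

lemma prob_space_outcome_space:
  assumes "is_protocol d n s l P" "prob_space G"
  shows "prob_space (outcome_space n s P G)"
proof -
  have fin: "finite {r :: bool list. length r = s}"
    using finite_lists_length_eq[of "UNIV :: bool set" s] by simp
  have ne: "{r :: bool list. length r = s} \<noteq> {}"
    using length_replicate[of s True] by blast
  have U: "prob_space (uniform_count_measure {r :: bool list. length r = s})"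
    by (rule prob_space_uniform_count_measure[OF fin ne])
  have PS: "prob_space (PiM {..<n} (private_seed P))" "prob_space (PiM {..<n} (\<lambda>_. G))"
    using assms by (auto simp: is_protocol_def intro!: prob_space_PiM)
  show ?thesis
    unfolding outcome_space_def using U PS by (intro prob_space_pair)
qed

text \<open>The event in \<open>output_prob\<close> is measurable, so \<open>measure\<close> does not default to 0 there.\<close>

lemma messages_measurable:
  assumes "is_protocol d n s l P" "sets G = sets (PiM {..<d} (\<lambda>_. borel))"
  shows "messages n P \<in> measurable (outcome_space n s P G)
     (PiM {..<n} (\<lambda>k. count_space {y. length y = l k}))"
proof -
  have cnt: "countable {r :: bool list. length r = s}" by simp
  let ?S = "PiM {..<n} (private_seed P) \<Otimes>\<^sub>M PiM {..<n} (\<lambda>_. G)"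
  have inner: "(\<lambda>p. \<lambda>k\<in>{..<n}. encoder P k r (fst p k) (snd p k))
      \<in> measurable ?S (PiM {..<n} (\<lambda>k. count_space {y. length y = l k}))"
    if r: "length r = s" for r
  proof (rule measurable_restrict)
    fix k assume k: "k \<in> {..<n}"
    have G: "sets (private_seed P k \<Otimes>\<^sub>M G)
        = sets (private_seed P k \<Otimes>\<^sub>M PiM {..<d} (\<lambda>_. borel))"
      by (intro sets_pair_measure_cong refl assms)
    have E: "(\<lambda>(u, x). encoder P k r u x)
        \<in> measurable (private_seed P k \<Otimes>\<^sub>M G) (count_space {y. length y = l k})"
      using assms(1) k r unfolding is_protocol_def
      by (simp add: measurable_cong_sets[OF G refl])
    have "(\<lambda>p. (fst p k, snd p k)) \<in> measurable ?S (private_seed P k \<Otimes>\<^sub>M G)"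
      using k by measurable
    from measurable_compose[OF this E]
    show "(\<lambda>p. encoder P k r (fst p k) (snd p k))
        \<in> measurable ?S (count_space {y. length y = l k})" by simp
  qed
  have C: "sets (outcome_space n s P G) = sets (count_space {r. length r = s} \<Otimes>\<^sub>M ?S)"
    unfolding outcome_space_def
    by (intro sets_pair_measure_cong refl) (simp add: sets_uniform_count_measure)
  have "messages n P = (\<lambda>(r, p). \<lambda>k\<in>{..<n}. encoder P k r (fst p k) (snd p k))"
    by (auto simp: messages_def fun_eq_iff)
  moreover have "(\<lambda>(r, p). \<lambda>k\<in>{..<n}. encoder P k r (fst p k) (snd p k))
      \<in> measurable (count_space {r. length r = s} \<Otimes>\<^sub>M ?S)
          (PiM {..<n} (\<lambda>k. count_space {y. length y = l k}))"
    by (rule measurable_pair_measure_countable1[OF cnt]) (simp add: inner)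
  ultimately show ?thesis
    by (simp only: measurable_cong_sets[OF C refl])
qed

lemma output_event_measurable:
  assumes "is_protocol d n s l P" "sets G = sets (PiM {..<d} (\<lambda>_. borel))"
  shows "{\<omega> \<in> space (outcome_space n s P G). test P (messages n P \<omega>) = b}
    \<in> sets (outcome_space n s P G)"
proof -
  let ?A = "\<lambda>k. {y :: bool list. length y = l k}"
  let ?M = "PiM {..<n} (\<lambda>k. count_space (?A k))"
  have fin: "finite (?A k)" for k
    using finite_lists_length_eq[of "UNIV :: bool set" "l k"] by simp
  have "?M = count_space (Pi\<^sub>E {..<n} ?A)"
    by (rule count_space_PiM_finite) (auto intro: countable_finite fin)
  then have "{m \<in> space ?M. test P m = b} \<in> sets ?M" by auto
  from measurable_sets[OF messages_measurable[OF assms] this]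
  show ?thesis
    by (rule back_subst[of "\<lambda>S. S \<in> sets _"])
      (use measurable_space[OF messages_measurable[OF assms]] in auto)
qed

end

theory Submission
  imports Defs
begin

text \<open>Let \<open>L\<close> be the longest message length. Cut the \<open>d\<close> coordinates into about \<open>L\<close> blocks of length
  \<open>B = d div L\<close> and project each block onto a random sign vector, using the same vector for all
  blocks. If the pairwise products of the signs are orthonormal, the energy of the projected mean
  has variance at most twice its squared expectation, so averaging over a constant number \<open>K\<close> of
  sign vectors keeps a fraction \<open>1 / B\<close> of \<open>\<parallel>\<mu>\<parallel>\<^sup>2\<close> with high probability. Walsh functions indexed by a
  greedily chosen three-sum-free family of index sets have this property and need only
  \<open>O(log (K * B))\<close> public bits.

  Each message bit is the sign of one projected coordinate of the sample, which is a biased coin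
  with bias of order \<open>min \<bar>t\<bar> 1\<close>, where \<open>t\<close> is the normalised projected mean. The bits of one user
  concern different blocks, so all bits are independent. The referee estimates the sum of the
  squared biases from products of two disjoint batches of bits and concludes by Chebyshev's
  inequality.\<close>

section \<open>Pairwise orthonormal signs from few random bits\<close>

text \<open>Greedy choice: \<open>m\<close> earlier sets give at most \<open>m ^ 3\<close> forbidden
  combinations, fewer than the \<open>2 ^ s\<close> subsets of \<open>{..<s}\<close>, so a further
  set is always available. The three earlier indices may coincide, and taking them equal shows that
  the sets are distinct.\<close>

lemma three_sum_free_sets:
  assumes "m ^ 3 \<le> 2 ^ s"
  shows "\<exists>c :: nat \<Rightarrow> nat set. (\<forall>y<m. c y \<subseteq> {..<s}) \<and>
    (\<forall>y<m. \<forall>x1<y. \<forall>x2<y. \<forall>x3<y. c y \<noteq> sym_diff (c x1) (sym_diff (c x2) (c x3)))"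
  using assms
proof (induction m)
  case (Suc m)
  have lt: "m ^ 3 < Suc m ^ 3"
    by (rule power_strict_mono) auto
  then have "m ^ 3 \<le> 2 ^ s" using Suc.prems by linarith
  from Suc.IH[OF this] obtain c where c: "\<forall>y<m. c y \<subseteq> {..<s}"
      "\<forall>y<m. \<forall>x1<y. \<forall>x2<y. \<forall>x3<y. c y \<noteq> sym_diff (c x1) (sym_diff (c x2) (c x3))"
    by blast
  let ?I = "{..<m} \<times> {..<m} \<times> {..<m}"
  let ?F = "(\<lambda>(x1, x2, x3). sym_diff (c x1) (sym_diff (c x2) (c x3))) ` ?I"
  have "card ?F \<le> card ?I" by (intro card_image_le) auto
  also have "\<dots> = m ^ 3" by (simp add: card_cartesian_product power3_eq_cube)
  also have "\<dots> < card (Pow {..<s})" using lt Suc.prems by (simp add: card_Pow)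
  finally have "\<not> Pow {..<s} \<subseteq> ?F" using card_mono[of ?F "Pow {..<s}"] by auto
  then obtain y where y: "y \<subseteq> {..<s}" "y \<notin> ?F" by blast
  have new: "y \<noteq> sym_diff (c x1) (sym_diff (c x2) (c x3))" if "x1 < m" "x2 < m" "x3 < m" for x1 x2 x3
  proof
    assume "y = sym_diff (c x1) (sym_diff (c x2) (c x3))"
    then have "y \<in> ?F" using that by (intro image_eqI[where x = "(x1, x2, x3)"]) auto
    then show False using y by simp
  qed
  show ?case
  proof (intro exI[of _ "c(m := y)"] conjI allI impI)
    fix z assume "z < Suc m" then show "(c(m := y)) z \<subseteq> {..<s}" using c(1) y(1) by auto
  next
    fix z x1 x2 x3 assume h: "z < Suc m" "x1 < z" "x2 < z" "x3 < z"
    then have [simp]: "x1 \<noteq> m" "x2 \<noteq> m" "x3 \<noteq> m" by auto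
    show "(c(m := y)) z \<noteq> sym_diff ((c(m := y)) x1) (sym_diff ((c(m := y)) x2) ((c(m := y)) x3))"
    proof (cases "z = m")
      case True then show ?thesis using new h by auto
    next
      case False then show ?thesis using c(2) h by (simp add: less_Suc_eq)
    qed
  qed
qed simp

section \<open>Walsh functions and their orthogonality\<close>

definition bit_sign :: "bool \<Rightarrow> real" where
  "bit_sign b = (if b then 1 else -1)"

lemma bit_sign_simps [simp]:
  "bit_sign True = 1" "bit_sign False = -1" "bit_sign b * bit_sign b = 1" "\<bar>bit_sign b\<bar> = 1"
  "bit_sign b ^ 2 = 1" "bit_sign (\<not> b) = - bit_sign b"
  by (auto simp: bit_sign_def)

text \<open>These are the characters of the group of bit strings under exclusive or.\<close>

definition walsh :: "nat set \<Rightarrow> bool list \<Rightarrow> real" where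
  "walsh D r = (\<Prod>i\<in>D. bit_sign (r ! i))"

text \<open>Bits indexed by the intersection occur twice, and their signs square to 1.\<close>

lemma walsh_mult:
  assumes "finite D" "finite E"
  shows "walsh D r * walsh E r = walsh (sym_diff D E) r"
proof -
  have D: "walsh D r = walsh (D - E) r * walsh (D \<inter> E) r"
    unfolding walsh_def using assms
    by (subst prod.union_disjoint[symmetric]) (auto intro!: prod.cong)
  have E: "walsh E r = walsh (E - D) r * walsh (D \<inter> E) r"
    unfolding walsh_def using assms
    by (subst prod.union_disjoint[symmetric]) (auto intro!: prod.cong)
  have I: "walsh (D \<inter> E) r * walsh (D \<inter> E) r = 1"
    unfolding walsh_def by (simp add: prod.distrib[symmetric])
  have "walsh (sym_diff D E) r = walsh (D - E) r * walsh (E - D) r"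
    unfolding walsh_def using assms by (subst prod.union_disjoint) auto
  then show ?thesis using D E I by (simp add: algebra_simps)
qed

lemma walsh_cases: "walsh D r = 1 \<or> walsh D r = -1"
proof -
  have "\<bar>walsh D r\<bar> = 1" by (simp add: walsh_def abs_prod)
  then show ?thesis by linarith
qed

lemma finite_bit_strings [simp]: "finite {r :: bool list. length r = s}"
  using finite_lists_length_eq[of "UNIV :: bool set" s] by simp

lemma card_bit_strings [simp]: "card {r :: bool list. length r = s} = 2 ^ s"
  using card_lists_length_eq[of "UNIV :: bool set" s] by simp

text \<open>Flipping one bit with index in \<open>D\<close> is an involution of the strings that
  negates every summand.\<close>

lemma sum_walsh:
  assumes "D \<subseteq> {..<s}" "D \<noteq> {}"
  shows "(\<Sum>r | length r = s. walsh D r) = 0"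
proof -
  obtain i where i: "i \<in> D" "i < s" using assms by auto
  have fin: "finite D" using assms by (meson finite_lessThan finite_subset)
  let ?f = "\<lambda>r :: bool list. r[i := \<not> r ! i]"
  have "(\<Sum>r | length r = s. walsh D r) = (\<Sum>r | length r = s. walsh D (?f r))"
    by (rule sum.reindex_bij_witness[of _ ?f ?f]) (use i in auto)
  also have "\<dots> = (\<Sum>r | length r = s. - walsh D r)"
  proof (intro sum.cong refl)
    fix r :: "bool list" assume r: "r \<in> {r. length r = s}"
    have "walsh D (?f r) = bit_sign (?f r ! i) * (\<Prod>j\<in>D-{i}. bit_sign (?f r ! j))"
      unfolding walsh_def using fin i by (simp add: prod.remove)
    also have "\<dots> = - bit_sign (r ! i) * (\<Prod>j\<in>D-{i}. bit_sign (r ! j))"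
      using r i by (auto intro!: prod.cong)
    also have "\<dots> = - walsh D r"
      unfolding walsh_def using fin i by (simp add: prod.remove)
    finally show "walsh D (?f r) = - walsh D r" .
  qed
  finally show ?thesis by (simp add: sum_negf)
qed

text \<open>Three-sum-freeness makes all pairwise symmetric differences of the index sets distinct, and
  distinct index sets have orthogonal Walsh functions.\<close>

lemma exists_pairwise_orthonormal_signs:
  assumes "m ^ 3 \<le> 2 ^ s"
  shows "\<exists>h :: bool list \<Rightarrow> nat \<Rightarrow> real. (\<forall>r x. h r x = 1 \<or> h r x = -1) \<and>
    (\<forall>y<m. \<forall>x<y. \<forall>y'<m. \<forall>x'<y'.
      (\<Sum>r | length r = s. (h r x * h r y) * (h r x' * h r y'))
        = (if x = x' \<and> y = y' then 2 ^ s else 0))"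
proof -
  from three_sum_free_sets[OF assms] obtain c :: "nat \<Rightarrow> nat set" where
    c: "\<And>y. y < m \<Longrightarrow> c y \<subseteq> {..<s}" and
    free: "\<And>y x1 x2 x3. \<lbrakk>y < m; x1 < y; x2 < y; x3 < y\<rbrakk> \<Longrightarrow>
      c y \<noteq> sym_diff (c x1) (sym_diff (c x2) (c x3))"
    by metis
  have inj: "c x \<noteq> c y" if "x < y" "y < m" for x y
    using free[of y x x x] that by auto
  have fin: "finite (c x)" if "x < m" for x
    using c[OF that] finite_subset by blast
  \<comment> \<open>If the larger indices \<open>y\<close> and \<open>y'\<close> differed, the
    equation would write the set with the largest index as a symmetric difference of three earlier
    ones. Once they agree, cancelling that set leaves \<open>c x = c x'\<close>.\<close>
  have sidon: "x = x' \<and> y = y'" if eq: "sym_diff (c x) (c y) = sym_diff (c x') (c y')"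
    and lt: "x < y" "y < m" "x' < y'" "y' < m" for x y x' y'
  proof -
    have "\<not> y < y'"
    proof
      assume "y < y'"
      then have "c y' \<noteq> sym_diff (c x') (sym_diff (c x) (c y))"
        using lt by (intro free) auto
      then show False unfolding eq by blast
    qed
    moreover have "\<not> y' < y"
    proof
      assume "y' < y"
      then have "c y \<noteq> sym_diff (c x) (sym_diff (c x') (c y'))"
        using lt by (intro free) auto
      then show False unfolding eq[symmetric] by blast
    qed
    ultimately have y: "y = y'" by simp
    have "c x = c x'" using eq unfolding y by blast
    then show ?thesis using y inj[of x x'] inj[of x' x] lt by (metis linorder_neqE_nat order_less_trans)
  qed
  show ?thesis
  proof (intro exI[of _ "\<lambda>r x. walsh (c x) r"] conjI allI impI walsh_cases)
    fix y x y' x' assume lt: "y < m" "x < y" "y' < m" "x' < y'"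
    then have lt': "x < m" "x' < m" by auto
    let ?D = "sym_diff (sym_diff (c x) (c y)) (sym_diff (c x') (c y'))"
    have w: "(walsh (c x) r * walsh (c y) r) * (walsh (c x') r * walsh (c y') r) = walsh ?D r" for r
      using lt lt' by (simp add: walsh_mult fin)
    have D: "?D \<subseteq> {..<s}" using c[OF lt(1)] c[OF lt(3)] c[OF lt'(1)] c[OF lt'(2)] by auto
    show "(\<Sum>r | length r = s. (walsh (c x) r * walsh (c y) r) * (walsh (c x') r * walsh (c y') r))
        = (if x = x' \<and> y = y' then 2 ^ s else 0)"
    proof (cases "x = x' \<and> y = y'")
      case True
      then have "?D = {}" by auto
      then show ?thesis unfolding w using True by (simp add: walsh_def)
    next
      case False
      then have "sym_diff (c x) (c y) \<noteq> sym_diff (c x') (c y')" using sidon lt by blast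
      then have "?D \<noteq> {}" by blast
      then show ?thesis unfolding w using False sum_walsh[OF D] by simp
    qed
  qed
qed

section \<open>Second moment of the energy kept by a random sign sketch\<close>

lemma square_sum_lessThan:
  fixes a :: "nat \<Rightarrow> real"
  shows "(\<Sum>e<B. a e)\<^sup>2 = (\<Sum>e<B. (a e)\<^sup>2) + 2 * (\<Sum>f<B. \<Sum>e<f. a e * a f)"
  by (induction B) (auto simp: power2_sum algebra_simps sum_distrib_left sum_distrib_right)

text \<open>Parseval's identity for an orthogonal family of common squared norm
  \<open>w\<close>.\<close>

lemma sum_squares_orthogonal:
  fixes \<xi> :: "'r \<Rightarrow> 'p \<Rightarrow> real"
  assumes "finite P" "\<And>p q. p \<in> P \<Longrightarrow> q \<in> P \<Longrightarrow> (\<Sum>r\<in>R. \<xi> r p * \<xi> r q) = (if p = q then w else 0)"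
  shows "(\<Sum>r\<in>R. (\<Sum>p\<in>P. \<xi> r p * a p)\<^sup>2) = w * (\<Sum>p\<in>P. (a p)\<^sup>2)"
proof -
  have "(\<Sum>r\<in>R. (\<Sum>p\<in>P. \<xi> r p * a p)\<^sup>2) = (\<Sum>r\<in>R. \<Sum>p\<in>P. \<Sum>q\<in>P. (\<xi> r p * \<xi> r q) * (a p * a q))"
    by (simp add: power2_eq_square sum_product mult_ac)
  also have "\<dots> = (\<Sum>p\<in>P. \<Sum>r\<in>R. \<Sum>q\<in>P. (\<xi> r p * \<xi> r q) * (a p * a q))"
    by (rule sum.swap)
  also have "\<dots> = (\<Sum>p\<in>P. \<Sum>q\<in>P. \<Sum>r\<in>R. (\<xi> r p * \<xi> r q) * (a p * a q))"
    by (intro sum.cong refl sum.swap)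
  also have "\<dots> = (\<Sum>p\<in>P. \<Sum>q\<in>P. (if p = q then w else 0) * (a p * a q))"
    using assms(2) by (intro sum.cong refl) (simp add: sum_distrib_right[symmetric])
  also have "\<dots> = (\<Sum>p\<in>P. \<Sum>q\<in>P. if p = q then w * (a p * a q) else 0)"
    by (intro sum.cong refl) simp
  also have "\<dots> = (\<Sum>p\<in>P. w * (a p)\<^sup>2)"
    using assms(1) by (simp add: power2_eq_square)
  finally show ?thesis by (simp add: sum_distrib_left)
qed

text \<open>Each of the \<open>K\<close> consecutive groups of \<open>B\<close> signs is one random
  vector, and it is applied to every one of the \<open>D\<close> rows of \<open>v\<close>. Sharing
  it between rows is what keeps the number of signs at \<open>K * B\<close>.\<close>

definition sketch_energy :: "nat \<Rightarrow> nat \<Rightarrow> nat \<Rightarrow> (nat \<Rightarrow> nat \<Rightarrow> real) \<Rightarrow> (nat \<Rightarrow> real) \<Rightarrow> real" where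
  "sketch_energy K D B v h = (\<Sum>g<K. \<Sum>b<D. (\<Sum>e<B. h (g * B + e) * v b e)\<^sup>2)"

text \<open>The deviation of the energy from its mean is a combination of the orthonormal pair products,
  weighted by the off-diagonal entries of the Gram matrix of the columns of \<open>v\<close>.\<close>

lemma sketch_energy_second_moment:
  fixes h :: "'r \<Rightarrow> nat \<Rightarrow> real" and v :: "nat \<Rightarrow> nat \<Rightarrow> real" and K D B :: nat and V :: real
  assumes sgn: "\<And>r x. h r x = 1 \<or> h r x = -1"
    and orth: "\<And>g f e g' f' e'. \<lbrakk>g < K; f < B; e < f; g' < K; f' < B; e' < f'\<rbrakk> \<Longrightarrow>
      (\<Sum>r\<in>R. (h r (g * B + e) * h r (g * B + f)) * (h r (g' * B + e') * h r (g' * B + f')))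
        = (if g = g' \<and> e = e' \<and> f = f' then w else 0)"
    and "w \<ge> 0"
  defines "V \<equiv> (\<Sum>b<D. \<Sum>e<B. (v b e)\<^sup>2)"
  shows "(\<Sum>r\<in>R. (sketch_energy K D B v (h r) - K * V)\<^sup>2) \<le> 2 * K * V\<^sup>2 * w"
proof -
  define A where "A e f = (\<Sum>b<D. v b e * v b f)" for e f
  define P where "P = {..<K} \<times> (SIGMA f:{..<B}. {..<f})"
  define \<xi> where "\<xi> r = (\<lambda>(g, f, e). h r (g * B + e) * h r (g * B + f))" for r
  define a where "a = (\<lambda>(g::nat, f, e). A e f)"
  have finP: "finite P" by (simp add: P_def)
  have sumP: "(\<Sum>p\<in>P. F p) = (\<Sum>g<K. \<Sum>f<B. \<Sum>e<f. F (g, f, e))" for F :: "_ \<Rightarrow> real"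
  proof -
    have "(\<Sum>q\<in>(SIGMA f:{..<B}. {..<f}). F (g, q)) = (\<Sum>f<B. \<Sum>e<f. F (g, f, e))" for g
      by (subst sum.Sigma) (auto simp: split_def)
    moreover have "(\<Sum>p\<in>P. F p) = (\<Sum>g<K. \<Sum>q\<in>(SIGMA f:{..<B}. {..<f}). F (g, q))"
      unfolding P_def by (subst sum.cartesian_product) (simp add: split_def)
    ultimately show ?thesis by simp
  qed
  have sq: "(h r x)\<^sup>2 = 1" for r x using sgn[of r x] by auto
  have V: "V = (\<Sum>e<B. A e e)"
    unfolding V_def A_def power2_eq_square by (rule sum.swap)
  have one: "(\<Sum>b<D. (\<Sum>e<B. h r (g * B + e) * v b e)\<^sup>2)
      = V + 2 * (\<Sum>f<B. \<Sum>e<f. \<xi> r (g, f, e) * A e f)" for r g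
  proof -
    have "(\<Sum>b<D. (\<Sum>e<B. h r (g * B + e) * v b e)\<^sup>2)
      = (\<Sum>b<D. (\<Sum>e<B. (v b e)\<^sup>2) + 2 * (\<Sum>f<B. \<Sum>e<f. \<xi> r (g, f, e) * (v b e * v b f)))"
      by (simp add: square_sum_lessThan power_mult_distrib sq \<xi>_def mult_ac)
    also have "\<dots> = V + 2 * (\<Sum>b<D. \<Sum>f<B. \<Sum>e<f. \<xi> r (g, f, e) * (v b e * v b f))"
      by (simp only: sum.distrib V_def sum_distrib_left)
    also have "(\<Sum>b<D. \<Sum>f<B. \<Sum>e<f. \<xi> r (g, f, e) * (v b e * v b f))
      = (\<Sum>f<B. \<Sum>b<D. \<Sum>e<f. \<xi> r (g, f, e) * (v b e * v b f))" by (rule sum.swap)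
    also have "\<dots> = (\<Sum>f<B. \<Sum>e<f. \<Sum>b<D. \<xi> r (g, f, e) * (v b e * v b f))"
      by (intro sum.cong refl sum.swap)
    finally show ?thesis by (simp add: A_def sum_distrib_left)
  qed
  have en: "sketch_energy K D B v (h r) - K * V = 2 * (\<Sum>p\<in>P. \<xi> r p * a p)" for r
    unfolding sketch_energy_def one sumP by (simp add: sum.distrib sum_distrib_left a_def)
  have "(\<Sum>r\<in>R. (sketch_energy K D B v (h r) - K * V)\<^sup>2) = 4 * (\<Sum>r\<in>R. (\<Sum>p\<in>P. \<xi> r p * a p)\<^sup>2)"
    unfolding en power_mult_distrib by (simp add: sum_distrib_left[symmetric])
  also have "(\<Sum>r\<in>R. (\<Sum>p\<in>P. \<xi> r p * a p)\<^sup>2) = w * (\<Sum>p\<in>P. (a p)\<^sup>2)"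
    by (rule sum_squares_orthogonal[OF finP]) (auto simp: P_def \<xi>_def orth split: if_splits)
  also have "(\<Sum>p\<in>P. (a p)\<^sup>2) = K * (\<Sum>f<B. \<Sum>e<f. (A e f)\<^sup>2)"
    unfolding sumP by (simp add: a_def)
  finally have eq: "(\<Sum>r\<in>R. (sketch_energy K D B v (h r) - K * V)\<^sup>2)
      = (4 * w * K) * (\<Sum>f<B. \<Sum>e<f. (A e f)\<^sup>2)" by simp
  \<comment> \<open>Cauchy-Schwarz replaces off-diagonal Gram entries by diagonal ones. Their
    products over pairs \<open>e < f\<close> sum to at most half the squared trace, and the trace is
    \<open>V\<close>.\<close>
  have "(A e f)\<^sup>2 \<le> A e e * A f f" for e f
    using Cauchy_Schwarz_ineq_sum[of "\<lambda>b. v b e" "\<lambda>b. v b f" "{..<D}"]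
    by (simp add: A_def power2_eq_square)
  then have "(\<Sum>f<B. \<Sum>e<f. (A e f)\<^sup>2) \<le> (\<Sum>f<B. \<Sum>e<f. A e e * A f f)"
    by (intro sum_mono)
  moreover have "0 \<le> (\<Sum>e<B. (A e e)\<^sup>2)" by (intro sum_nonneg) simp
  then have "(\<Sum>f<B. \<Sum>e<f. A e e * A f f) \<le> V\<^sup>2 / 2"
    using square_sum_lessThan[of "\<lambda>e. A e e" B] unfolding V by linarith
  ultimately have "(4 * w * K) * (\<Sum>f<B. \<Sum>e<f. (A e f)\<^sup>2) \<le> (4 * w * K) * (V\<^sup>2 / 2)"
    using \<open>w \<ge> 0\<close> by (intro mult_left_mono) auto
  then show ?thesis unfolding eq by (simp add: mult_ac)
qed

text \<open>Chebyshev's inequality in counting form: each bad seed contributes at least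
  \<open>(K * V / 2)\<^sup>2\<close> to a second moment of at most
  \<open>2 * K * V\<^sup>2 * card R\<close>.\<close>

lemma card_low_sketch_energy:
  fixes h :: "'r \<Rightarrow> nat \<Rightarrow> real" and v :: "nat \<Rightarrow> nat \<Rightarrow> real" and K D B :: nat and V :: real
  assumes sgn: "\<And>r x. h r x = 1 \<or> h r x = -1"
    and orth: "\<And>g f e g' f' e'. \<lbrakk>g < K; f < B; e < f; g' < K; f' < B; e' < f'\<rbrakk> \<Longrightarrow>
      (\<Sum>r\<in>R. (h r (g * B + e) * h r (g * B + f)) * (h r (g' * B + e') * h r (g' * B + f')))
        = (if g = g' \<and> e = e' \<and> f = f' then real (card R) else 0)"
    and R: "finite R"
    and V: "V = (\<Sum>b<D. \<Sum>e<B. (v b e)\<^sup>2)" "V > 0" and K: "K > 0"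
  shows "card {r\<in>R. sketch_energy K D B v (h r) < K * V / 2} \<le> 8 / K * card R"
proof -
  let ?bad = "{r\<in>R. sketch_energy K D B v (h r) < K * V / 2}"
  have "card ?bad * (K * V / 2)\<^sup>2 = (\<Sum>r\<in>?bad. (K * V / 2)\<^sup>2)" by simp
  also have "\<dots> \<le> (\<Sum>r\<in>?bad. (sketch_energy K D B v (h r) - K * V)\<^sup>2)"
  proof (intro sum_mono)
    fix r assume "r \<in> ?bad"
    then have "sketch_energy K D B v (h r) < K * V / 2" by simp
    then have "K * V / 2 \<le> K * V - sketch_energy K D B v (h r)" by linarith
    then have "(K * V / 2)\<^sup>2 \<le> (K * V - sketch_energy K D B v (h r))\<^sup>2"
      using V(2) by (intro power_mono) auto
    then show "(K * V / 2)\<^sup>2 \<le> (sketch_energy K D B v (h r) - K * V)\<^sup>2"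
      by (simp add: power2_commute)
  qed
  also have "\<dots> \<le> (\<Sum>r\<in>R. (sketch_energy K D B v (h r) - K * V)\<^sup>2)"
    using R by (intro sum_mono2) auto
  also have "\<dots> \<le> 2 * K * V\<^sup>2 * card R"
    unfolding V(1) by (rule sketch_energy_second_moment[OF sgn orth]) auto
  finally have "real (card ?bad) * K * (K * V\<^sup>2 / 4) \<le> 8 * card R * (K * V\<^sup>2 / 4)"
    by (simp add: power2_eq_square field_simps)
  then have "real (card ?bad) * K \<le> 8 * card R"
    using V(2) K by (simp add: mult_le_cancel_right)
  then show ?thesis using K by (simp add: field_simps)
qed

section \<open>Signs of Gaussian projections\<close>

abbreviation std_normal :: "real measure" where
  "std_normal \<equiv> density lborel (\<lambda>x. ennreal (std_normal_density x))"

text \<open>This is 2 Phi(t) - 1, where Phi is the standard normal distribution function.\<close>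

definition sign_bias :: "real \<Rightarrow> real" where
  "sign_bias t = (\<integral>x. bit_sign (0 \<le> t + x) \<partial>std_normal)"

lemma bit_sign_measurable [measurable]: "bit_sign \<in> measurable (count_space UNIV) borel"
  by simp

lemma prob_space_std_normal: "prob_space std_normal"
  by (rule prob_space_normal_density) simp

lemma distributed_std_normal: "distributed std_normal lborel (\<lambda>x. x) std_normal_density"
  unfolding distributed_def by (auto simp: distr_id2)

text \<open>Dividing by a positive \<open>\<sigma>\<close> does not change the sign, so only the
  normalised mean matters.\<close>

lemma sign_mean_normal:
  assumes Y: "distributed M lborel Y (normal_density m \<sigma>)" and "prob_space M" "\<sigma> > 0"
  shows "(\<integral>x. bit_sign (0 \<le> Y x) \<partial>M) = sign_bias (m / \<sigma>)"
proof -
  interpret prob_space M by fact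
  have Z: "distributed M lborel (\<lambda>x. (Y x - m) / \<sigma>) std_normal_density"
    using Y normal_standard_normal_convert[OF \<open>\<sigma> > 0\<close>] by simp
  have "sign_bias (m / \<sigma>) = (\<integral>x. std_normal_density x * bit_sign (0 \<le> m / \<sigma> + x) \<partial>lborel)"
    unfolding sign_bias_def by (subst integral_real_density) auto
  also have "\<dots> = (\<integral>x. bit_sign (0 \<le> m / \<sigma> + (Y x - m) / \<sigma>) \<partial>M)"
    by (rule distributed_integral[OF Z]) auto
  also have "\<dots> = (\<integral>x. bit_sign (0 \<le> Y x) \<partial>M)"
    using \<open>\<sigma> > 0\<close> by (simp add: diff_divide_distrib zero_le_divide_iff)
  finally show ?thesis ..
qed

text \<open>Reflecting the standard normal flips the sign, except at \<open>x = - t\<close>, where a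
  zero counts as positive on both sides. That point is a null set.\<close>

lemma sign_bias_minus: "sign_bias (- t) = - sign_bias t"
proof -
  interpret prob_space std_normal by (rule prob_space_std_normal)
  have D: "distributed std_normal lborel (\<lambda>x. - x) std_normal_density"
    using normal_density_affine[OF distributed_std_normal, of "-1" 0] by simp
  have "sign_bias (- t) = (\<integral>x. std_normal_density x * bit_sign (0 \<le> - t + x) \<partial>lborel)"
    unfolding sign_bias_def by (subst integral_real_density) auto
  also have "\<dots> = (\<integral>x. bit_sign (0 \<le> - t + - x) \<partial>std_normal)"
    by (rule distributed_integral[OF D]) auto
  also have "\<dots> = (\<integral>x. - bit_sign (0 \<le> t + x) \<partial>std_normal)"
  proof (rule integral_cong_AE)
    have "AE x in lborel. x \<noteq> - t" by (rule AE_lborel_singleton)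
    then have "AE x in std_normal. x \<noteq> - t" by (subst AE_density) auto
    then show "AE x in std_normal. bit_sign (0 \<le> - t + - x) = - bit_sign (0 \<le> t + x)"
      by eventually_elim (auto simp: bit_sign_def)
  qed auto
  finally show ?thesis by (simp add: sign_bias_def)
qed

lemma sign_bias_0 [simp]: "sign_bias 0 = 0"
  using sign_bias_minus[of 0] by simp

text \<open>Compared with the unbiased case \<open>t = 0\<close>, a shift by \<open>t\<close> raises
  the sign from -1 to 1 on an interval containing \<open>{- min t 1 ..< 0}\<close>. There the
  density is at least (1 / 2) / 3 = 1 / 6, so the gain is at least 2 * (1 / 6) times the
  length.\<close>

lemma sign_bias_lower_nonneg:
  assumes "t \<ge> 0"
  shows "min t 1 / 3 \<le> sign_bias t"
proof -
  interpret prob_space std_normal by (rule prob_space_std_normal)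
  let ?I = "{- min t 1 ..< 0}"
  have int: "integrable std_normal (\<lambda>x. bit_sign (0 \<le> s + x))" for s
    by (rule integrable_const_bound[of _ 1]) auto
  have int_I: "integrable std_normal (\<lambda>x. 2 * indicator ?I x :: real)"
    by (rule integrable_const_bound[of _ 2]) (auto simp: indicator_def)
  have dens: "1 / 6 \<le> std_normal_density x" if "x \<in> ?I" for x
  proof -
    have "x\<^sup>2 \<le> 1" using that by (auto simp: abs_square_le_1)
    then have "1 / 2 \<le> exp (- x\<^sup>2 / 2)" using exp_ge_add_one_self[of "- x\<^sup>2 / 2"] by simp
    moreover have "sqrt (2 * pi) \<le> 3"
      by (rule real_le_lsqrt) (use pi_less_4 in auto)
    ultimately have "1 / 2 / 3 \<le> exp (- x\<^sup>2 / 2) / sqrt (2 * pi)"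
      by (intro frac_le) auto
    then show ?thesis by (simp add: std_normal_density_def)
  qed
  have "ennreal (min t 1 / 6) = ennreal (1 / 6) * emeasure lborel ?I"
    using assms by (simp add: ennreal_mult'[symmetric])
  also have "\<dots> = (\<integral>\<^sup>+x. ennreal (1 / 6) * indicator ?I x \<partial>lborel)"
    by (simp add: nn_integral_cmult_indicator)
  also have "\<dots> \<le> (\<integral>\<^sup>+x. ennreal (std_normal_density x) * indicator ?I x \<partial>lborel)"
    using dens by (intro nn_integral_mono) (auto simp: indicator_def intro: ennreal_leI)
  also have "\<dots> = emeasure std_normal ?I"
    by (subst emeasure_density) auto
  finally have "min t 1 / 6 \<le> measure std_normal ?I"
    by (simp add: emeasure_eq_measure)
  then have "min t 1 / 3 \<le> 2 * measure std_normal ?I" by simp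
  also have "\<dots> = (\<integral>x. 2 * indicator ?I x \<partial>std_normal)" by simp
  also have "\<dots> \<le> (\<integral>x. bit_sign (0 \<le> t + x) - bit_sign (0 \<le> 0 + x) \<partial>std_normal)"
    using assms by (intro integral_mono Bochner_Integration.integrable_diff int int_I)
      (auto simp: indicator_def bit_sign_def)
  also have "\<dots> = sign_bias t - sign_bias 0"
    unfolding sign_bias_def by (rule Bochner_Integration.integral_diff) (rule int)+
  finally show ?thesis by simp
qed

text \<open>Oddness removes the sign of \<open>t\<close>. The squared form is the one that is summed
  over all projected coordinates.\<close>

lemma sign_bias_square_lower: "min (t\<^sup>2) 1 / 9 \<le> (sign_bias t)\<^sup>2"
proof -
  have "min \<bar>t\<bar> 1 / 3 \<le> \<bar>sign_bias t\<bar>"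
    using sign_bias_lower_nonneg[of t] sign_bias_lower_nonneg[of "- t"] sign_bias_minus[of t]
    by (cases "t \<ge> 0") auto
  then have "(min \<bar>t\<bar> 1 / 3)\<^sup>2 \<le> \<bar>sign_bias t\<bar>\<^sup>2" by (intro power_mono) auto
  moreover have "(min \<bar>t\<bar> 1)\<^sup>2 = min (t\<^sup>2) 1"
    by (cases "\<bar>t\<bar> \<le> 1") (auto simp: min_def abs_square_le_1)
  ultimately show ?thesis by (simp add: power_divide)
qed

section \<open>Independence across coordinates, blocks and users\<close>

lemma indep_vars_PiM_coordinates:
  assumes "\<And>i. i \<in> I \<Longrightarrow> prob_space (M i)"
  shows "prob_space.indep_vars (PiM I M) M (\<lambda>i x. x i) I"
proof (cases "I = {}")
  case True
  interpret prob_space "PiM I M" using assms by (rule prob_space_PiM)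
  show ?thesis unfolding indep_vars_def indep_sets_def using True by auto
next
  case False
  interpret prob_space "PiM I M" using assms by (rule prob_space_PiM)
  \<comment> \<open>Restriction to \<open>I\<close> is the identity on the product space, so the
    joint law of the coordinates is the product of their marginals. The criterion applied below
    needs a nonempty index set, hence the case split.\<close>
  have "distr (PiM I M) (PiM I M) (\<lambda>x. \<lambda>i\<in>I. x i) = PiM I M"
    using distr_cong[of "PiM I M" "PiM I M" "PiM I M" "PiM I M" "\<lambda>x. \<lambda>i\<in>I. x i" "\<lambda>x. x"]
    by (simp add: space_PiM distr_id PiE_restrict)
  also have "\<dots> = (\<Pi>\<^sub>M i\<in>I. distr (PiM I M) (M i) (\<lambda>x. x i))"
    using assms by (intro PiM_cong refl) (simp add: distr_PiM_component)
  finally show ?thesis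
    by (subst indep_vars_iff_distr_eq_PiM'[OF False]) auto
qed

text \<open>Signs square to 1, so the projection is a normal variable of variance
  \<open>card S\<close>, which gives the normalisation by its square root.\<close>

lemma gaussian_linear_sign_mean:
  assumes S: "S \<subseteq> {..<d}" "S \<noteq> {}" and w: "\<And>i. i \<in> S \<Longrightarrow> w i = 1 \<or> w i = -1"
  shows "(\<integral>x. bit_sign (0 \<le> (\<Sum>i\<in>S. w i * x i)) \<partial>gaussian d \<mu>)
    = sign_bias ((\<Sum>i\<in>S. w i * \<mu> i) / sqrt (card S))"
proof -
  let ?N = "\<lambda>i. density lborel (\<lambda>y. ennreal (normal_density (\<mu> i) 1 y))"
  interpret prob_space "gaussian d \<mu>" by (rule prob_space_gaussian)
  have fin: "finite S" using S finite_subset by blast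
  have "indep_vars ?N (\<lambda>i x. x i) {..<d}"
    unfolding gaussian_eq_PiM by (intro indep_vars_PiM_coordinates prob_space_unit_variance_normal)
  then have "indep_vars ?N (\<lambda>i x. x i) S" using S(1) by (rule indep_vars_subset)
  then have ind: "indep_vars (\<lambda>_. borel) (\<lambda>i x. w i * x i) S"
    by (rule indep_vars_compose2) auto
  have D: "distributed (gaussian d \<mu>) lborel (\<lambda>x. w i * x i) (normal_density (w i * \<mu> i) 1)"
    if i: "i \<in> S" for i
  proof -
    have id: "i < d" using S(1) i by auto
    have "distr (gaussian d \<mu>) lborel (\<lambda>x. x i) = distr (gaussian d \<mu>) (?N i) (\<lambda>x. x i)"
      by (intro distr_cong) auto
    also have "\<dots> = ?N i"
      unfolding gaussian_eq_PiM using id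
      by (intro distr_PiM_component prob_space_unit_variance_normal) auto
    finally have "distributed (gaussian d \<mu>) lborel (\<lambda>x. x i) (normal_density (\<mu> i) 1)"
      using id by (auto simp: distributed_def)
    from normal_density_affine[OF this, of "w i" 0] show ?thesis using w[OF i] by auto
  qed
  have "distributed (gaussian d \<mu>) lborel (\<lambda>x. \<Sum>i\<in>S. w i * x i)
      (normal_density (\<Sum>i\<in>S. w i * \<mu> i) (sqrt (\<Sum>i\<in>S. 1\<^sup>2)))"
    by (rule sum_indep_normal[OF fin S(2) ind _ D]) auto
  from sign_mean_normal[OF this prob_space_gaussian] show ?thesis
    using fin S(2) by (simp add: card_gt_0_iff)
qed

text \<open>Projections supported on disjoint coordinate sets of one product Gaussian are
  independent, so the mean factors.\<close>

lemma gaussian_sign_product_mean: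
  assumes "finite J" and S: "\<And>j. j \<in> J \<Longrightarrow> S j \<subseteq> {..<d}" "\<And>j. j \<in> J \<Longrightarrow> S j \<noteq> {}"
    and disj: "disjoint_family_on S J"
    and w: "\<And>j i. w j i = 1 \<or> w j i = (-1 :: real)"
  shows "(\<integral>x. (\<Prod>j\<in>J. bit_sign (0 \<le> (\<Sum>i\<in>S j. w j i * x i))) \<partial>gaussian d \<mu>)
    = (\<Prod>j\<in>J. sign_bias ((\<Sum>i\<in>S j. w j i * \<mu> i) / sqrt (card (S j))))"
proof -
  let ?N = "\<lambda>i. density lborel (\<lambda>y. ennreal (normal_density (\<mu> i) 1 y))"
  interpret prob_space "gaussian d \<mu>" by (rule prob_space_gaussian)
  have "indep_vars ?N (\<lambda>i x. x i) {..<d}"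
    unfolding gaussian_eq_PiM by (intro indep_vars_PiM_coordinates prob_space_unit_variance_normal)
  from indep_vars_restrict[OF this S(1) disj]
  have "indep_vars (\<lambda>j. PiM (S j) ?N) (\<lambda>j x. restrict x (S j)) J" by simp
  then have "indep_vars (\<lambda>_. borel)
      (\<lambda>j x. bit_sign (0 \<le> (\<Sum>i\<in>S j. w j i * restrict x (S j) i))) J"
    by (rule indep_vars_compose2[where Y = "\<lambda>j x. bit_sign (0 \<le> (\<Sum>i\<in>S j. w j i * x i))"])
       measurable
  then have ind: "indep_vars (\<lambda>_. borel) (\<lambda>j x. bit_sign (0 \<le> (\<Sum>i\<in>S j. w j i * x i))) J"
    by simp
  have "integrable (gaussian d \<mu>) (\<lambda>x. bit_sign (0 \<le> (\<Sum>i\<in>S j. w j i * x i)))" if "j \<in> J" for j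
    using ind that unfolding indep_vars_def by (intro integrable_const_bound[of _ 1]) auto
  from indep_vars_lebesgue_integral[OF \<open>finite J\<close> ind this] show ?thesis
    using S w by (simp add: gaussian_linear_sign_mean)
qed

text \<open>The product is grouped by user. Different users hold independent samples, so their bits
  may read overlapping coordinates; disjointness matters only within one user.\<close>

lemma user_signs_product_mean:
  fixes F :: "'b set" and u :: "'b \<Rightarrow> nat"
  assumes F: "finite F" and u: "\<And>j. j \<in> F \<Longrightarrow> u j < n"
    and S: "\<And>j. j \<in> F \<Longrightarrow> S j \<subseteq> {..<d}" "\<And>j. j \<in> F \<Longrightarrow> S j \<noteq> {}"
    and disj: "\<And>i j. \<lbrakk>i \<in> F; j \<in> F; i \<noteq> j; u i = u j\<rbrakk> \<Longrightarrow> S i \<inter> S j = {}"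
    and w: "\<And>j i. w j i = 1 \<or> w j i = (-1 :: real)"
  shows "(\<integral>x. (\<Prod>j\<in>F. bit_sign (0 \<le> (\<Sum>i\<in>S j. w j i * x (u j) i))) \<partial>PiM {..<n} (\<lambda>_. gaussian d \<mu>))
    = (\<Prod>j\<in>F. sign_bias ((\<Sum>i\<in>S j. w j i * \<mu> i) / sqrt (card (S j))))"
proof -
  interpret product_prob_space "\<lambda>_::nat. gaussian d \<mu>"
    by (rule product_prob_spaceI) (rule prob_space_gaussian)
  let ?F = "\<lambda>k. {j\<in>F. u j = k}"
  have grp: "(\<Prod>j\<in>F. g j) = (\<Prod>k<n. \<Prod>j\<in>?F k. g j)" for g :: "'b \<Rightarrow> real"
    using prod.group[OF F finite_lessThan, of u n g] u by (simp add: image_subset_iff)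
  let ?f = "\<lambda>k y. \<Prod>j\<in>?F k. bit_sign (0 \<le> (\<Sum>i\<in>S j. w j i * y i))"
  have meas: "(\<lambda>y. \<Sum>i\<in>S j. w j i * y i) \<in> borel_measurable (gaussian d \<mu>)" if "j \<in> F" for j
  proof (intro borel_measurable_sum borel_measurable_times borel_measurable_const)
    fix i assume "i \<in> S j"
    then have "i \<in> {..<d}" using S(1)[OF that] by auto
    then show "(\<lambda>y. y i) \<in> borel_measurable (gaussian d \<mu>)" by simp
  qed
  have int: "integrable (gaussian d \<mu>) (?f k)" for k
  proof (rule M.integrable_const_bound[of _ 1])
    show "?f k \<in> borel_measurable (gaussian d \<mu>)"
      by (intro borel_measurable_prod measurable_compose[OF _ bit_sign_measurable])
         (use meas in auto)
  qed (simp add: abs_prod)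
  have "(\<integral>x. (\<Prod>j\<in>F. bit_sign (0 \<le> (\<Sum>i\<in>S j. w j i * x (u j) i))) \<partial>PiM {..<n} (\<lambda>_. gaussian d \<mu>))
    = (\<integral>x. (\<Prod>k<n. ?f k (x k)) \<partial>PiM {..<n} (\<lambda>_. gaussian d \<mu>))"
    unfolding grp by (intro Bochner_Integration.integral_cong refl prod.cong) auto
  also have "\<dots> = (\<Prod>k<n. integral\<^sup>L (gaussian d \<mu>) (?f k))"
    by (rule product_integral_prod) (auto intro: int)
  also have "\<dots> = (\<Prod>k<n. \<Prod>j\<in>?F k. sign_bias ((\<Sum>i\<in>S j. w j i * \<mu> i) / sqrt (card (S j))))"
    using F S disj w by (intro prod.cong refl gaussian_sign_product_mean) (auto simp: disjoint_family_on_def)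
  finally show ?thesis unfolding grp .
qed

section \<open>Estimating the total squared bias of independent signs\<close>

text \<open>Multiplying sums over two disjoint halves of the rounds gives an unbiased estimate of
  \<open>m\<^sup>2 * (\<Sum>q<N. (\<beta> q)\<^sup>2)\<close> whose variance involves second moments only.\<close>

definition paired_statistic :: "nat \<Rightarrow> nat \<Rightarrow> (nat \<times> nat \<Rightarrow> real) \<Rightarrow> real" where
  "paired_statistic N m \<sigma> = (\<Sum>q<N. (\<Sum>i<m. \<sigma> (q, i)) * (\<Sum>j<m. \<sigma> (q, m + j)))"

text \<open>Independence enters only through \<open>mean\<close>, in the form of product
  expectations over sets of distinct entries. A row is one sketch coordinate with a common bias, a
  column is one round.\<close>

locale sign_array = prob_space +
  fixes N m :: nat and \<sigma> :: "nat \<times> nat \<Rightarrow> 'a \<Rightarrow> real" and \<beta> :: "nat \<Rightarrow> real"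
  assumes sgn: "\<And>p x. \<sigma> p x = 1 \<or> \<sigma> p x = -1"
    and meas: "\<And>p. p \<in> {..<N} \<times> {..<2 * m} \<Longrightarrow> \<sigma> p \<in> borel_measurable M"
    and mean: "\<And>F. F \<subseteq> {..<N} \<times> {..<2 * m} \<Longrightarrow>
      expectation (\<lambda>x. \<Prod>p\<in>F. \<sigma> p x) = (\<Prod>p\<in>F. \<beta> (fst p))"
begin

abbreviation statistic :: "'a \<Rightarrow> real" where
  "statistic x \<equiv> paired_statistic N m (\<lambda>p. \<sigma> p x)"

definition energy :: real where
  "energy = (\<Sum>q<N. (\<beta> q)\<^sup>2)"

definition pair_prod :: "nat \<times> nat \<times> nat \<Rightarrow> 'a \<Rightarrow> real" where
  "pair_prod = (\<lambda>(q, i, j) x. \<sigma> (q, i) x * \<sigma> (q, m + j) x)"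

definition pairs :: "(nat \<times> nat \<times> nat) set" where
  "pairs = {..<N} \<times> {..<m} \<times> {..<m}"

section \<open>Mean and variance of the paired statistic\<close>

lemma sum_pairs: "(\<Sum>p\<in>pairs. F p) = (\<Sum>q<N. \<Sum>i<m. \<Sum>j<m. F (q, i, j))" for F :: "_ \<Rightarrow> real"
  unfolding pairs_def sum.cartesian_product by (simp add: split_def)

lemma finite_pairs: "finite pairs" by (simp add: pairs_def)

lemma statistic_eq: "statistic x = (\<Sum>p\<in>pairs. pair_prod p x)"
  by (simp add: sum_pairs paired_statistic_def pair_prod_def sum_product)

lemma sgn_square: "\<sigma> p x * \<sigma> p x = 1"
  using sgn[of p x] by auto

lemma abs_pair_prod: "\<bar>pair_prod p x\<bar> = 1"
proof -
  have "\<bar>\<sigma> p x\<bar> = 1" for p using sgn[of p x] by auto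
  then show ?thesis by (simp add: pair_prod_def split_def abs_mult)
qed

lemma measurable_pair_prod: "p \<in> pairs \<Longrightarrow> pair_prod p \<in> borel_measurable M"
  unfolding pair_prod_def pairs_def
  by (auto intro!: borel_measurable_times meas)

lemma integrable_pair_prod: "p \<in> pairs \<Longrightarrow> integrable M (pair_prod p)"
  by (rule integrable_const_bound[of _ 1]) (auto simp: abs_pair_prod measurable_pair_prod)

lemma integrable_pair_prod_mult:
  "p \<in> pairs \<Longrightarrow> p' \<in> pairs \<Longrightarrow> integrable M (\<lambda>x. pair_prod p x * pair_prod p' x)"
  by (rule integrable_const_bound[of _ 1])
     (auto simp: abs_mult abs_pair_prod intro!: borel_measurable_times measurable_pair_prod)

lemma mean_pair_prod:
  assumes "(q, i, j) \<in> pairs"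
  shows "expectation (pair_prod (q, i, j)) = (\<beta> q)\<^sup>2"
proof -
  have "pair_prod (q, i, j) = (\<lambda>x. \<Prod>p\<in>{(q, i), (q, m + j)}. \<sigma> p x)"
    using assms by (auto simp: pair_prod_def pairs_def fun_eq_iff)
  then show ?thesis
    using assms mean[of "{(q, i), (q, m + j)}"] by (auto simp: pairs_def power2_eq_square)
qed

text \<open>A sign shared by both pair products squares to 1 and drops out. Two shared signs leave
  1, one shared sign leaves two distinct entries of the row with mean
  \<open>(\<beta> q)\<^sup>2\<close>, and otherwise the mean factors. All terms are nonnegative, so
  the exceptional values may be added to the generic one.\<close>

lemma mean_pair_prod_mult_le:
  assumes p: "(q, i, j) \<in> pairs" "(q', i', j') \<in> pairs"
  shows "expectation (\<lambda>x. pair_prod (q, i, j) x * pair_prod (q', i', j') x)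
    \<le> (\<beta> q)\<^sup>2 * (\<beta> q')\<^sup>2 + (if q = q' \<and> i = i' \<and> j = j' then 1 else 0)
      + (if q = q' \<and> i = i' then (\<beta> q)\<^sup>2 else 0) + (if q = q' \<and> j = j' then (\<beta> q)\<^sup>2 else 0)"
    (is "?E \<le> _")
proof -
  have lt: "q < N" "i < m" "j < m" "q' < N" "i' < m" "j' < m" using p by (auto simp: pairs_def)
  consider "q = q'" "i = i'" "j = j'" | "q = q'" "i = i'" "j \<noteq> j'" | "q = q'" "i \<noteq> i'" "j = j'"
    | "q \<noteq> q' \<or> (i \<noteq> i' \<and> j \<noteq> j')" by blast
  then show ?thesis
  proof cases
    case 1
    have eq: "(\<lambda>x. pair_prod (q, i, j) x * pair_prod (q', i', j') x) = (\<lambda>x. 1)"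
      using 1 abs_pair_prod by (auto simp: fun_eq_iff abs_eq_iff' power2_eq_square[symmetric] abs_square_eq_1)
    show ?thesis unfolding eq using 1 by (simp add: prob_space)
  next
    case 2
    have eq: "(\<lambda>x. pair_prod (q, i, j) x * pair_prod (q', i', j') x)
        = (\<lambda>x. \<Prod>p\<in>{(q, m + j), (q, m + j')}. \<sigma> p x)"
    proof
      fix x
      have "pair_prod (q, i, j) x * pair_prod (q', i', j') x
          = (\<sigma> (q, i) x * \<sigma> (q, i) x) * (\<sigma> (q, m + j) x * \<sigma> (q, m + j') x)"
        using 2 by (simp add: pair_prod_def)
      then show "pair_prod (q, i, j) x * pair_prod (q', i', j') x
          = (\<Prod>p\<in>{(q, m + j), (q, m + j')}. \<sigma> p x)" using 2 by (simp add: sgn_square)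
    qed
    have "?E = (\<beta> q)\<^sup>2" unfolding eq
      using lt 2 by (subst mean) (auto simp: power2_eq_square)
    then show ?thesis using 2 by simp
  next
    case 3
    have eq: "(\<lambda>x. pair_prod (q, i, j) x * pair_prod (q', i', j') x)
        = (\<lambda>x. \<Prod>p\<in>{(q, i), (q, i')}. \<sigma> p x)"
    proof
      fix x
      have "pair_prod (q, i, j) x * pair_prod (q', i', j') x
          = (\<sigma> (q, m + j) x * \<sigma> (q, m + j) x) * (\<sigma> (q, i) x * \<sigma> (q, i') x)"
        using 3 by (simp add: pair_prod_def)
      then show "pair_prod (q, i, j) x * pair_prod (q', i', j') x
          = (\<Prod>p\<in>{(q, i), (q, i')}. \<sigma> p x)" using 3 by (simp add: sgn_square)
    qed
    have "?E = (\<beta> q)\<^sup>2" unfolding eq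
      using lt 3 by (subst mean) (auto simp: power2_eq_square)
    then show ?thesis using 3 by simp
  next
    case 4
    \<comment> \<open>First factors use columns below \<open>m\<close> and second factors columns
      from \<open>m\<close> on, so in this case the four entries are distinct.\<close>
    have d: "(q, i) \<noteq> (q', i')" "(q, m + j) \<noteq> (q', m + j')" "(q, i) \<noteq> (q, m + j)"
      "(q, i) \<noteq> (q', m + j')" "(q', i') \<noteq> (q, m + j)" "(q', i') \<noteq> (q', m + j')"
      using 4 lt by auto
    let ?F = "{(q, i), (q, m + j), (q', i'), (q', m + j')}"
    have eq: "(\<lambda>x. pair_prod (q, i, j) x * pair_prod (q', i', j') x) = (\<lambda>x. \<Prod>p\<in>?F. \<sigma> p x)"
      using d by (auto simp: pair_prod_def fun_eq_iff)
    have "?E = (\<Prod>p\<in>?F. \<beta> (fst p))" unfolding eq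
      using lt by (intro mean) auto
    also have "\<dots> = (\<beta> q)\<^sup>2 * (\<beta> q')\<^sup>2"
      using d by (auto simp: power2_eq_square)
    finally show ?thesis by simp
  qed
qed

lemma integrable_statistic: "integrable M statistic"
  unfolding statistic_eq by (intro Bochner_Integration.integrable_sum integrable_pair_prod)

lemma expectation_statistic: "expectation statistic = (real m)\<^sup>2 * energy"
proof -
  have "expectation statistic = (\<Sum>p\<in>pairs. expectation (pair_prod p))"
    unfolding statistic_eq by (intro Bochner_Integration.integral_sum integrable_pair_prod)
  also have "\<dots> = (\<Sum>p\<in>pairs. (\<beta> (fst p))\<^sup>2)"
    by (intro sum.cong refl) (auto simp: mean_pair_prod)
  finally show ?thesis
    by (simp add: sum_pairs energy_def sum_distrib_left power2_eq_square mult_ac)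
qed

lemma integrable_statistic_square: "integrable M (\<lambda>x. (statistic x)\<^sup>2)"
  unfolding statistic_eq power2_eq_square sum_product
  by (intro Bochner_Integration.integrable_sum integrable_pair_prod_mult)

text \<open>The generic terms add up to the squared mean and cancel. Identical triples contribute
  \<open>N * (real m)\<^sup>2\<close>, and sharing the left or the right sign contributes
  \<open>(real m) ^ 3 * energy\<close> each.\<close>

lemma variance_statistic_le:
  "variance statistic \<le> N * (real m)\<^sup>2 + 2 * (real m) ^ 3 * energy"
proof -
  let ?g = "\<lambda>p p'. (\<beta> (fst p))\<^sup>2 * (\<beta> (fst p'))\<^sup>2"
  let ?I0 = "\<lambda>p p'. if p = p' then 1 else 0 :: real"
  let ?I1 = "\<lambda>(q, i, j) (q', i', j'). if q = q' \<and> i = i' then (\<beta> q)\<^sup>2 else 0"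
  let ?I2 = "\<lambda>(q, i, j) (q', i', j'). if q = q' \<and> j = j' then (\<beta> q)\<^sup>2 else 0"
  \<comment> \<open>Nesting the conditions lets the simplifier collapse the sums over the second
    triple one index at a time.\<close>
  have split: "(if P \<and> Q then c else 0) = (if Q then if P then c else 0 else 0)" for P Q and c :: real
    by simp
  have "expectation (\<lambda>x. (statistic x)\<^sup>2)
      = (\<Sum>p\<in>pairs. \<Sum>p'\<in>pairs. expectation (\<lambda>x. pair_prod p x * pair_prod p' x))"
    unfolding statistic_eq power2_eq_square sum_product
    by (simp add: Bochner_Integration.integral_sum integrable_pair_prod_mult)
  also have "\<dots> \<le> (\<Sum>p\<in>pairs. \<Sum>p'\<in>pairs. ?g p p' + ?I0 p p' + ?I1 p p' + ?I2 p p')"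
  proof (intro sum_mono)
    fix p p' assume "p \<in> pairs" "p' \<in> pairs"
    then show "expectation (\<lambda>x. pair_prod p x * pair_prod p' x) \<le> ?g p p' + ?I0 p p' + ?I1 p p' + ?I2 p p'"
      using mean_pair_prod_mult_le by (cases p, cases p') (simp only: prod.case fst_conv prod.inject)
  qed
  also have "\<dots> = (\<Sum>p\<in>pairs. \<Sum>p'\<in>pairs. ?g p p') + (\<Sum>p\<in>pairs. \<Sum>p'\<in>pairs. ?I0 p p')
      + (\<Sum>p\<in>pairs. \<Sum>p'\<in>pairs. ?I1 p p') + (\<Sum>p\<in>pairs. \<Sum>p'\<in>pairs. ?I2 p p')"
    by (simp only: sum.distrib)
  also have "(\<Sum>p\<in>pairs. \<Sum>p'\<in>pairs. ?g p p') = (\<Sum>p\<in>pairs. (\<beta> (fst p))\<^sup>2)\<^sup>2"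
    by (simp only: power2_eq_square sum_product)
  also have "(\<Sum>p\<in>pairs. (\<beta> (fst p))\<^sup>2) = (real m)\<^sup>2 * energy"
    by (simp add: sum_pairs energy_def sum_distrib_left power2_eq_square mult_ac)
  also have "(\<Sum>p\<in>pairs. \<Sum>p'\<in>pairs. ?I0 p p') = N * (real m)\<^sup>2"
    by (simp add: finite_pairs) (simp add: pairs_def power2_eq_square)
  also have "(\<Sum>p\<in>pairs. \<Sum>p'\<in>pairs. ?I1 p p') = (real m) ^ 3 * energy"
    by (simp add: sum_pairs split energy_def sum_distrib_left power3_eq_cube mult_ac
        if_distrib[of "(*) _"] cong: if_cong)
  also have "(\<Sum>p\<in>pairs. \<Sum>p'\<in>pairs. ?I2 p p') = (real m) ^ 3 * energy"
    by (simp add: sum_pairs split energy_def sum_distrib_left power3_eq_cube mult_ac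
        if_distrib[of "(*) _"] cong: if_cong)
  finally have le: "expectation (\<lambda>x. (statistic x)\<^sup>2)
      \<le> ((real m)\<^sup>2 * energy)\<^sup>2 + N * (real m)\<^sup>2 + (real m) ^ 3 * energy + (real m) ^ 3 * energy" .
  have "variance statistic = expectation (\<lambda>x. (statistic x)\<^sup>2) - ((real m)\<^sup>2 * energy)\<^sup>2"
    using variance_eq[OF integrable_statistic integrable_statistic_square]
    by (simp add: expectation_statistic)
  then show ?thesis using le by linarith
qed

lemma statistic_deviation:
  assumes "a > 0"
  shows "prob {x \<in> space M. a \<le> \<bar>statistic x - (real m)\<^sup>2 * energy\<bar>}
    \<le> (N * (real m)\<^sup>2 + 2 * (real m) ^ 3 * energy) / a\<^sup>2"
proof -
  have "prob {x \<in> space M. a \<le> \<bar>statistic x - expectation statistic\<bar>} \<le> variance statistic / a\<^sup>2"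
    using assms integrable_statistic
    by (intro Chebyshev_inequality integrable_statistic_square) auto
  also have "\<dots> \<le> (N * (real m)\<^sup>2 + 2 * (real m) ^ 3 * energy) / a\<^sup>2"
    by (intro divide_right_mono variance_statistic_le) simp
  finally show ?thesis by (simp only: expectation_statistic)
qed

section \<open>The two error probabilities of the threshold test\<close>

lemma measurable_statistic: "statistic \<in> borel_measurable M"
  using integrable_statistic by auto

text \<open>Without energy the statistic has mean 0 and standard deviation at most
  \<open>m * sqrt N\<close>, while \<open>sep\<close> puts the threshold at 200 times this value or
  more.\<close>

lemma false_alarm_prob:
  fixes \<kappa> :: real
  assumes "energy = 0" and sep: "400 * sqrt N \<le> m * \<kappa>" and "N > 0" "\<kappa> > 0"
  shows "prob {x \<in> space M. (real m)\<^sup>2 * \<kappa> / 2 \<le> statistic x} \<le> 1 / 10"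
proof -
  let ?a = "(real m)\<^sup>2 * \<kappa> / 2"
  have "0 < 400 * sqrt N" using \<open>N > 0\<close> by simp
  then have pos: "0 < m * \<kappa>" using sep by linarith
  then have m: "m > 0" using \<open>\<kappa> > 0\<close> by (simp add: zero_less_mult_iff)
  then have a: "?a > 0" using \<open>\<kappa> > 0\<close> by simp
  have "(400 * sqrt N)\<^sup>2 \<le> (m * \<kappa>)\<^sup>2" using sep by (intro power_mono) auto
  then have N: "160000 * N \<le> (m * \<kappa>)\<^sup>2" by (simp add: power_mult_distrib)
  have "prob {x \<in> space M. ?a \<le> statistic x}
      \<le> prob {x \<in> space M. ?a \<le> \<bar>statistic x - (real m)\<^sup>2 * energy\<bar>}"
    using measurable_statistic assms(1) by (intro finite_measure_mono) auto
  also have "\<dots> \<le> (N * (real m)\<^sup>2) / ?a\<^sup>2"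
    using statistic_deviation[OF a] assms(1) by simp
  also have "\<dots> = 4 * N / (m * \<kappa>)\<^sup>2"
    using m \<open>\<kappa> > 0\<close> by (simp add: field_simps power2_eq_square)
  also have "\<dots> \<le> 1 / 10"
    using N pos by (simp add: divide_le_eq)
  finally show ?thesis .
qed

text \<open>The threshold is at most half the mean, so a miss is a deviation by half the mean.
  Relative to its square, the variance terms are governed by \<open>m * energy\<close>, which is at
  least \<open>400 * sqrt N\<close>. The bound 1 / 20 leaves room for the probability of a bad
  public seed.\<close>

lemma missed_detection_prob:
  fixes \<kappa> :: real
  assumes en: "\<kappa> \<le> energy" and sep: "400 * sqrt N \<le> m * \<kappa>" and "N > 0" "\<kappa> > 0"
  shows "prob {x \<in> space M. statistic x < (real m)\<^sup>2 * \<kappa> / 2} \<le> 1 / 20"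
proof -
  let ?a = "(real m)\<^sup>2 * energy / 2" and ?b = "m * energy"
  have e: "energy > 0" using assms by linarith
  have s: "1 \<le> sqrt N" using \<open>N > 0\<close> by simp
  have "m * \<kappa> \<le> ?b" using en by (intro mult_left_mono) auto
  then have b: "400 * sqrt N \<le> ?b" using sep by linarith
  then have b': "400 \<le> ?b" using s by linarith
  have m: "m > 0" using b' by (cases m) auto
  have a: "?a > 0" using m e by simp
  have "(400 * sqrt N)\<^sup>2 \<le> ?b\<^sup>2" using b by (intro power_mono) auto
  then have N: "160000 * N \<le> ?b\<^sup>2" by (simp add: power_mult_distrib)
  have th: "(real m)\<^sup>2 * \<kappa> / 2 \<le> ?a" using en by (simp add: mult_left_mono)
  have "prob {x \<in> space M. statistic x < (real m)\<^sup>2 * \<kappa> / 2}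
      \<le> prob {x \<in> space M. ?a \<le> \<bar>statistic x - (real m)\<^sup>2 * energy\<bar>}"
  proof (intro finite_measure_mono Collect_mono impI)
    fix x assume "x \<in> space M \<and> statistic x < (real m)\<^sup>2 * \<kappa> / 2"
    then show "x \<in> space M \<and> ?a \<le> \<bar>statistic x - (real m)\<^sup>2 * energy\<bar>"
      using th a by linarith
  qed (use measurable_statistic in auto)
  also have "\<dots> \<le> (N * (real m)\<^sup>2 + 2 * (real m) ^ 3 * energy) / ?a\<^sup>2"
    by (rule statistic_deviation[OF a])
  also have "\<dots> = 4 * N / ?b\<^sup>2 + 8 / ?b"
    using m e by (simp add: field_simps power2_eq_square power3_eq_cube)
  also have "\<dots> \<le> 4 / 160000 + 8 / 400"
    using N b' by (intro add_mono) (simp_all add: divide_le_eq)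
  finally show ?thesis by simp
qed

end

section \<open>The sketching protocol\<close>

lemma sum_lessThan_mult:
  fixes f :: "nat \<Rightarrow> real"
  shows "(\<Sum>i<n * k. f i) = (\<Sum>b<n. \<Sum>e<k. f (b * k + e))"
proof -
  have "(\<Sum>i\<in>{a..<a + k}. f i) = (\<Sum>e<k. f (a + e))" for a
    by (rule sum.reindex_bij_witness[of _ "\<lambda>e. a + e" "\<lambda>i. i - a"]) auto
  then show ?thesis by (simp add: sum.nat_group[symmetric])
qed

text \<open>Fubini over the public bits reduces the analysis to a fixed string \<open>r\<close>,
  that is, to fixed signs.\<close>

lemma output_prob_eq_average:
  assumes P: "is_protocol d n s l P" and G: "sets G = sets (PiM {..<d} (\<lambda>_. borel))" "prob_space G"
  shows "output_prob n s P G b = (\<Sum>r | length r = s.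
      measure (PiM {..<n} (private_seed P) \<Otimes>\<^sub>M PiM {..<n} (\<lambda>_. G))
        {p \<in> space (PiM {..<n} (private_seed P) \<Otimes>\<^sub>M PiM {..<n} (\<lambda>_. G)).
          test P (messages n P (r, p)) = b}) / 2 ^ s"
proof -
  let ?U = "uniform_count_measure {r :: bool list. length r = s}"
  let ?S = "PiM {..<n} (private_seed P) \<Otimes>\<^sub>M PiM {..<n} (\<lambda>_. G)"
  let ?E = "{\<omega> \<in> space (outcome_space n s P G). test P (messages n P \<omega>) = b}"
  let ?p = "\<lambda>r. measure ?S {p \<in> space ?S. test P (messages n P (r, p)) = b}"
  have PS: "prob_space (PiM {..<n} (private_seed P))" "prob_space (PiM {..<n} (\<lambda>_. G))"
    using P G by (auto simp: is_protocol_def intro!: prob_space_PiM)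
  interpret S: prob_space ?S using PS by (rule prob_space_pair)
  interpret O: prob_space "outcome_space n s P G" by (rule prob_space_outcome_space[OF P G(2)])
  have E: "?E \<in> sets (?U \<Otimes>\<^sub>M ?S)"
    using output_event_measurable[OF P G(1)] unfolding outcome_space_def .
  have sec: "Pair r -` ?E = {p \<in> space ?S. test P (messages n P (r, p)) = b}" if "length r = s" for r
    using that by (auto simp: outcome_space_def space_pair_measure space_uniform_count_measure)
  have int: "integrable ?U ?p"
    unfolding uniform_count_measure_def by (rule integrable_point_measure_finite) simp
  have "emeasure (outcome_space n s P G) ?E = (\<integral>\<^sup>+r. emeasure ?S (Pair r -` ?E) \<partial>?U)"
    unfolding outcome_space_def using E[unfolded outcome_space_def]
    by (rule S.emeasure_pair_measure_alt)
  also have "\<dots> = (\<integral>\<^sup>+r. ennreal (?p r) \<partial>?U)"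
  proof (intro nn_integral_cong)
    fix r assume "r \<in> space ?U"
    then have "length r = s" by (simp add: space_uniform_count_measure)
    then show "emeasure ?S (Pair r -` ?E) = ennreal (?p r)"
      by (simp only: sec S.emeasure_eq_measure)
  qed
  also have "\<dots> = ennreal (\<integral>r. ?p r \<partial>?U)"
    by (rule nn_integral_eq_integral[OF int]) simp
  also have "(\<integral>r. ?p r \<partial>?U) = (\<Sum>r | length r = s. ?p r) / 2 ^ s"
    by (simp add: integral_uniform_count_measure)
  finally show ?thesis
    unfolding output_prob_def
    by (intro measure_eq_emeasure_eq_ennreal divide_nonneg_nonneg sum_nonneg) auto
qed

text \<open>The transmitted bits are numbered \<open>t = 0, 1, \<dots>\<close> across all users. Bit \<open>t\<close> concerns the sketch
  coordinate \<open>q = t mod N\<close>, where \<open>q = g * D + b\<close> means repetition \<open>g < K\<close> and block \<open>b < D\<close>. Since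
  \<open>D\<close> divides \<open>N\<close> and a user owns at most \<open>D\<close> consecutive bits, its bits read disjoint blocks and are
  therefore independent. \<open>K = 160\<close> makes the failure probability \<open>8 / K\<close> of the seed equal to
  \<open>1 / 20\<close>.\<close>

locale sketch_protocol =
  fixes d n s :: nat and l :: "nat \<Rightarrow> nat" and \<epsilon> :: real
    and K B D m :: nat and h :: "bool list \<Rightarrow> nat \<Rightarrow> real"
  assumes d: "d \<ge> 1" and B: "B \<ge> 1" and D_def: "D = (d - 1) div B + 1"
    and l_le: "\<And>k. k < n \<Longrightarrow> l k \<le> D"
    and h: "\<And>r x. h r x = 1 \<or> h r x = -1"
    and orth: "\<And>g f e g' f' e'. \<lbrakk>g < K; f < B; e < f; g' < K; f' < B; e' < f'\<rbrakk> \<Longrightarrow>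
      (\<Sum>r | length r = s. (h r (g * B + e) * h r (g * B + f)) * (h r (g' * B + e') * h r (g' * B + f')))
        = (if g = g' \<and> e = e' \<and> f = f' then 2 ^ s else 0)"
    and K: "K = 160" and rounds: "2 * m * (K * D) \<le> l1_norm n l"
    and eps: "0 < \<epsilon>" "\<epsilon> \<le> 1"
    and separation: "400 * sqrt (K * D) \<le> m * (\<epsilon>\<^sup>2 / (9 * B))"
begin

abbreviation "N \<equiv> K * D"

abbreviation "\<kappa> \<equiv> \<epsilon>\<^sup>2 / (9 * B)"

definition offset :: "nat \<Rightarrow> nat" where
  "offset k = (\<Sum>j<k. l j)"

text \<open>Taking the least such \<open>k\<close> skips users with empty messages.\<close>

definition owner :: "nat \<Rightarrow> nat" where
  "owner t = (LEAST k. t < offset (Suc k))"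

text \<open>\<open>D\<close> is \<open>d / B\<close> rounded up, so the last block may be shorter
  than \<open>B\<close>.\<close>

definition block :: "nat \<Rightarrow> nat set" where
  "block t = {i. i < d \<and> i div B = t mod D}"

text \<open>\<open>(t mod N) div D\<close> is the repetition, which selects a group of
  \<open>B\<close> signs, and \<open>i mod B\<close> is the position inside the block. The sign does
  not depend on which block is read.\<close>

definition coeff :: "bool list \<Rightarrow> nat \<Rightarrow> nat \<Rightarrow> real" where
  "coeff r t i = h r ((t mod N) div D * B + i mod B)"

definition sketch_bit :: "bool list \<Rightarrow> nat \<Rightarrow> (nat \<Rightarrow> real) \<Rightarrow> bool" where
  "sketch_bit r t x \<longleftrightarrow> 0 \<le> (\<Sum>i\<in>block t. coeff r t i * x i)"

text \<open>The private seed is a point mass, so all randomness of the encoders is public. Entry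
  \<open>(q, i)\<close> of the sign table is transmitted bit \<open>i * N + q\<close>. The threshold
  is half of \<open>(real m)\<^sup>2 * \<kappa>\<close>, a lower bound for the expected statistic
  under the alternative for a good seed.\<close>

definition sketch_test :: protocol where
  "sketch_test = \<lparr>private_seed = \<lambda>_. return borel 0,
        encoder = \<lambda>k r _ x. map (\<lambda>t. sketch_bit r (offset k + t) x) [0..<l k],
        test = \<lambda>y. (real m)\<^sup>2 * \<kappa> / 2 \<le> paired_statistic N m
          (\<lambda>(q, i). let t = i * N + q in bit_sign (y (owner t) ! (t - offset (owner t))))\<rparr>"

definition sample_sign :: "bool list \<Rightarrow> nat \<times> nat \<Rightarrow> (nat \<Rightarrow> nat \<Rightarrow> real) \<Rightarrow> real" where
  "sample_sign r = (\<lambda>(q, i) x. let t = i * N + q in bit_sign (sketch_bit r t (x (owner t))))"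

definition bias :: "bool list \<Rightarrow> (nat \<Rightarrow> real) \<Rightarrow> nat \<Rightarrow> real" where
  "bias r \<mu> q = sign_bias ((\<Sum>i\<in>block q. coeff r q i * \<mu> i) / sqrt (card (block q)))"

section \<open>Numbering of bits and geometry of blocks\<close>

lemma D_pos: "D > 0" by (simp add: D_def)

lemma N_pos: "N > 0" by (simp add: D_pos K)

lemma kappa_pos: "\<kappa> > 0" using eps B by simp

lemma owner_props:
  assumes "t < l1_norm n l"
  shows "owner t < n" "offset (owner t) \<le> t" "t < offset (owner t) + l (owner t)"
proof -
  have n: "n \<noteq> 0" using assms by (cases n) (auto simp: l1_norm_def)
  have ex: "t < offset (Suc (n - 1))" using assms n by (simp add: offset_def l1_norm_def)
  then have 1: "t < offset (Suc (owner t))" unfolding owner_def by (rule LeastI)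
  have "owner t \<le> n - 1" unfolding owner_def using ex by (rule Least_le)
  then show "owner t < n" using n by simp
  show "t < offset (owner t) + l (owner t)" using 1 by (simp add: offset_def)
  show "offset (owner t) \<le> t"
  proof (cases "owner t")
    case (Suc k)
    then have "\<not> t < offset (Suc k)" unfolding owner_def by (intro not_less_Least) simp
    then show ?thesis using Suc by simp
  qed (simp add: offset_def)
qed

lemma index_bound:
  assumes "q < N" "i < 2 * m"
  shows "i * N + q < l1_norm n l"
proof -
  have "i * N + q < Suc i * N" using assms by simp
  also have "\<dots> \<le> 2 * m * N" using assms by (intro mult_le_mono1) simp
  finally show ?thesis using rounds by simp
qed

text \<open>The first coordinate \<open>(t mod D) * B\<close> is at most \<open>d - 1\<close> by the
  choice of \<open>D\<close>. A nonempty block makes the projection a nondegenerate normal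
  variable.\<close>

lemma block_nonempty: "block t \<noteq> {}"
proof -
  have "t mod D \<le> (d - 1) div B" using D_pos mod_less_divisor[of D t] by (simp add: D_def)
  then have "(t mod D) * B \<le> (d - 1) div B * B" by simp
  also have "\<dots> \<le> d - 1" by (rule div_times_less_eq_dividend)
  finally have "(t mod D) * B \<in> block t" using d B by (auto simp: block_def)
  then show ?thesis by blast
qed

lemma block_subset: "block t \<subseteq> {..<d}" by (auto simp: block_def)

lemma finite_block: "finite (block t)" using block_subset finite_subset by blast

lemma block_image:
  "block t = (\<lambda>e. t mod D * B + e) ` {e. e < B \<and> t mod D * B + e < d}"
proof -
  have "i \<in> (\<lambda>e. t mod D * B + e) ` {e. e < B \<and> t mod D * B + e < d}" if "i \<in> block t" for i
  proof (rule image_eqI[where x = "i mod B"])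
    show "i = t mod D * B + i mod B" using that div_mult_mod_eq[of i B] by (simp add: block_def)
    then show "i mod B \<in> {e. e < B \<and> t mod D * B + e < d}"
      using that B by (auto simp: block_def)
  qed
  moreover have "t mod D * B + e \<in> block t" if "e < B" "t mod D * B + e < d" for e
    using that by (auto simp: block_def)
  ultimately show ?thesis by blast
qed

lemma card_block_le: "card (block t) \<le> B"
proof -
  have "card (block t) \<le> card {e. e < B \<and> t mod D * B + e < d}"
    unfolding block_image by (intro card_image_le) simp
  also have "\<dots> \<le> card {..<B}" by (intro card_mono) auto
  finally show ?thesis by simp
qed

lemma block_sum: "(\<Sum>i\<in>block t. f i) = (\<Sum>e<B. if t mod D * B + e < d then f (t mod D * B + e) else 0)"
  for f :: "nat \<Rightarrow> real"
proof -
  have "(\<Sum>i\<in>block t. f i) = (\<Sum>e | e < B \<and> t mod D * B + e < d. f (t mod D * B + e))"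
    unfolding block_image by (subst sum.reindex) (auto simp: inj_on_def)
  also have "\<dots> = (\<Sum>e\<in>{e \<in> {..<B}. t mod D * B + e < d}. f (t mod D * B + e))" by simp
  also have "\<dots> = (\<Sum>e<B. if t mod D * B + e < d then f (t mod D * B + e) else 0)"
    by (rule sum.inter_filter) simp
  finally show ?thesis .
qed

text \<open>Every round repeats the same \<open>N\<close> projections, so all entries of a row have
  the same bias.\<close>

lemma shift_index:
  assumes "q < N"
  shows "block (i * N + q) = block q" "coeff r (i * N + q) = coeff r q"
proof -
  have "(i * N + q) mod D = q mod D"
    by (metis mod_mult_self3 mult.assoc)
  then show "block (i * N + q) = block q" by (simp add: block_def)
  show "coeff r (i * N + q) = coeff r q" by (simp add: coeff_def fun_eq_iff)
qed

lemma disjoint_blocks: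
  assumes "t < l1_norm n l" "t' < l1_norm n l" "owner t = owner t'" "t \<noteq> t'"
  shows "block t \<inter> block t' = {}"
proof -
  have ne: "t mod D \<noteq> t' mod D"
    if h: "t < t'" "t' < l1_norm n l" "t < l1_norm n l" "owner t = owner t'" for t t'
  proof
    assume "t mod D = t' mod D"
    then have "D dvd t' - t" using h(1) mod_eq_dvd_iff_nat[of t t' D] by simp
    then have "D \<le> t' - t" using h(1) by (intro dvd_imp_le) auto
    moreover have "t' - t < l (owner t)"
      using owner_props[OF h(2)] owner_props[OF h(3)] h(4) by auto
    ultimately show False using l_le[OF owner_props(1)[OF h(3)]] by simp
  qed
  have "t mod D \<noteq> t' mod D"
    using ne[of t t'] ne[of t' t] assms by (metis linorder_neqE_nat)
  then show ?thesis by (auto simp: block_def)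
qed

section \<open>Admissibility of the protocol and independence of its bits\<close>

lemma sketch_bit_measurable:
  assumes "sets G = sets (PiM {..<d} (\<lambda>_. borel))"
  shows "sketch_bit r t \<in> measurable G (count_space UNIV)"
proof -
  have "(\<lambda>x. \<Sum>i\<in>block t. coeff r t i * x i) \<in> borel_measurable (PiM {..<d} (\<lambda>_. borel))"
    using block_subset[of t] by (intro borel_measurable_sum borel_measurable_times) auto
  then have "(\<lambda>x. 0 \<le> (\<Sum>i\<in>block t. coeff r t i * x i)) \<in> measurable (PiM {..<d} (\<lambda>_. borel)) (count_space UNIV)"
    by measurable
  then show ?thesis unfolding sketch_bit_def[abs_def] using assms by (simp cong: measurable_cong_sets)
qed

lemma is_protocol_sketch_test: "is_protocol d n s l sketch_test"
  unfolding is_protocol_def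
proof (intro allI impI conjI)
  fix k show "prob_space (private_seed sketch_test k)" by (simp add: sketch_test_def prob_space_return)
next
  fix k and r :: "bool list"
  let ?X = "PiM {..<d} (\<lambda>_. borel :: real measure)"
  let ?A = "{y :: bool list. length y = l k}"
  let ?f = "\<lambda>x. map (\<lambda>t. sketch_bit r (offset k + t) x) [0..<l k]"
  have fin: "finite ?A" by simp
  have "?f \<in> measurable ?X (count_space ?A)"
  proof (subst measurable_count_space_eq2[OF fin], intro conjI ballI)
    fix y assume y: "y \<in> ?A"
    have "?f -` {y} \<inter> space ?X = {x \<in> space ?X. \<forall>t\<in>{..<l k}. sketch_bit r (offset k + t) x = y ! t}"
      using y by (auto simp: list_eq_iff_nth_eq)
    also have "\<dots> \<in> sets ?X"
      using sketch_bit_measurable[of ?X r] by (intro sets.sets_Collect_finite_All) auto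
    finally show "?f -` {y} \<inter> space ?X \<in> sets ?X" .
  qed auto
  then show "(\<lambda>(u, x). encoder sketch_test k r u x)
      \<in> measurable (private_seed sketch_test k \<Otimes>\<^sub>M ?X) (count_space ?A)"
    unfolding sketch_test_def by (simp add: split_def)
qed

text \<open>By \<open>rounds\<close>, every bit read by the statistic lies within the total budget,
  so each lookup hits a valid position of its owner's message.\<close>

lemma test_messages:
  "test sketch_test (messages n sketch_test (r, u, x)) \<longleftrightarrow>
    (real m)\<^sup>2 * \<kappa> / 2 \<le> paired_statistic N m (\<lambda>p. sample_sign r p x)"
proof -
  have "(let t = i * N + q in bit_sign (messages n sketch_test (r, u, x) (owner t) ! (t - offset (owner t))))
      = sample_sign r (q, i) x" if "q < N" "i < 2 * m" for q i
  proof -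
    note own = owner_props[OF index_bound[OF that]]
    then have "i * N + q - offset (owner (i * N + q)) < l (owner (i * N + q))" by linarith
    then show ?thesis using own by (simp add: messages_def sketch_test_def sample_sign_def Let_def)
  qed
  then have "paired_statistic N m (\<lambda>(q, i). let t = i * N + q in
        bit_sign (messages n sketch_test (r, u, x) (owner t) ! (t - offset (owner t))))
      = paired_statistic N m (\<lambda>p. sample_sign r p x)"
    unfolding paired_statistic_def by (intro sum.cong arg_cong2[where f = "(*)"] refl) auto
  then show ?thesis by (simp add: sketch_test_def)
qed

text \<open>Distinct table entries are distinct transmitted bits. Those of one owner read disjoint
  blocks, those of different owners use independent samples.\<close>

lemma sign_array_sample_sign:
  "sign_array (PiM {..<n} (\<lambda>_. gaussian d \<mu>)) N m (sample_sign r) (bias r \<mu>)"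
proof -
  let ?M = "PiM {..<n} (\<lambda>_. gaussian d \<mu>)"
  interpret prob_space ?M by (intro prob_space_PiM prob_space_gaussian)
  let ?t = "\<lambda>p. snd p * N + fst p"
  have inj: "?t p \<noteq> ?t p'" if "fst p < N" "fst p' < N" "p \<noteq> p'" for p p' :: "nat \<times> nat"
  proof
    assume eq: "?t p = ?t p'"
    have "fst p = ?t p mod N" "fst p' = ?t p' mod N" using that by auto
    moreover have "snd p = ?t p div N" "snd p' = ?t p' div N" using that N_pos by (simp_all add: D_pos K)
    ultimately have "p = p'" using eq by (metis prod_eqI)
    then show False using that(3) by simp
  qed
  show ?thesis
  proof unfold_locales
    fix p x show "sample_sign r p x = 1 \<or> sample_sign r p x = -1"
      by (auto simp: sample_sign_def Let_def bit_sign_def split: prod.split)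
  next
    fix p :: "nat \<times> nat" assume p: "p \<in> {..<N} \<times> {..<2 * m}"
    then have "owner (?t p) < n" using owner_props(1)[OF index_bound] by auto
    then have "(\<lambda>x. x (owner (?t p))) \<in> measurable ?M (gaussian d \<mu>)" by simp
    from measurable_compose[OF measurable_compose[OF this sketch_bit_measurable] bit_sign_measurable]
    show "sample_sign r p \<in> borel_measurable ?M"
      by (simp add: sample_sign_def split_def Let_def)
  next
    fix F :: "(nat \<times> nat) set" assume F: "F \<subseteq> {..<N} \<times> {..<2 * m}"
    then have fin: "finite F" using finite_subset by blast
    have lt: "?t p < l1_norm n l" if "p \<in> F" for p
      using F that by (intro index_bound) auto
    have "(\<integral>x. (\<Prod>p\<in>F. sample_sign r p x) \<partial>?M)
      = (\<integral>x. (\<Prod>p\<in>F. bit_sign (0 \<le> (\<Sum>i\<in>block (?t p). coeff r (?t p) i * x (owner (?t p)) i))) \<partial>?M)"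
      by (simp add: sample_sign_def split_def Let_def sketch_bit_def)
    also have "\<dots> = (\<Prod>p\<in>F. sign_bias ((\<Sum>i\<in>block (?t p). coeff r (?t p) i * \<mu> i)
        / sqrt (card (block (?t p)))))"
    proof (rule user_signs_product_mean[OF fin])
      fix p p' assume p: "p \<in> F" "p' \<in> F" "p \<noteq> p'" "owner (?t p) = owner (?t p')"
      have "?t p \<noteq> ?t p'" using p F by (intro inj) auto
      then show "block (?t p) \<inter> block (?t p') = {}"
        using p lt by (intro disjoint_blocks) auto
    qed (use owner_props(1)[OF lt] block_subset block_nonempty h in \<open>auto simp: coeff_def\<close>)
    also have "\<dots> = (\<Prod>p\<in>F. bias r \<mu> (fst p))"
    proof (intro prod.cong refl)
      fix p assume "p \<in> F"
      then have "fst p < N" using F by auto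
      from shift_index[OF this]
      show "sign_bias ((\<Sum>i\<in>block (?t p). coeff r (?t p) i * \<mu> i) / sqrt (card (block (?t p))))
        = bias r \<mu> (fst p)" by (simp only: bias_def)
    qed
    finally show "(\<integral>x. (\<Prod>p\<in>F. sample_sign r p x) \<partial>?M) = (\<Prod>p\<in>F. bias r \<mu> (fst p))" .
  qed
qed

section \<open>From the norm of the mean to the energy of the biases\<close>

definition padded :: "(nat \<Rightarrow> real) \<Rightarrow> nat \<Rightarrow> nat \<Rightarrow> real" where
  "padded \<mu> b e = (if b * B + e < d then \<mu> (b * B + e) else 0)"

lemma padded_norm: "(\<Sum>b<D. \<Sum>e<B. (padded \<mu> b e)\<^sup>2) = (\<Sum>i<d. (\<mu> i)\<^sup>2)"
proof -
  have "d - 1 < D * B" unfolding D_def using B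
    by (metis Suc_eq_plus1 dividend_less_div_times less_le_trans zero_less_one add.commute mult_Suc)
  then have le: "d \<le> D * B" using d by simp
  have "(\<Sum>b<D. \<Sum>e<B. (padded \<mu> b e)\<^sup>2) = (\<Sum>i<D * B. (if i < d then \<mu> i else 0)\<^sup>2)"
    by (simp add: sum_lessThan_mult padded_def)
  also have "\<dots> = (\<Sum>i<d. (if i < d then \<mu> i else 0)\<^sup>2)"
    using le by (intro sum.mono_neutral_right) auto
  finally show ?thesis by simp
qed

text \<open>Writing \<open>q = g * D + b\<close> separates repetition and block; the zero padding
  accounts for a short last block.\<close>

lemma sketch_energy_eq:
  "(\<Sum>q<N. (\<Sum>i\<in>block q. coeff r q i * \<mu> i)\<^sup>2) = sketch_energy K D B (padded \<mu>) (h r)"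
proof -
  have "(\<Sum>i\<in>block (g * D + b). coeff r (g * D + b) i * \<mu> i) = (\<Sum>e<B. h r (g * B + e) * padded \<mu> b e)"
    if gb: "g \<in> {..<K}" "b \<in> {..<D}" for g b
  proof -
    have "g * D + b < Suc g * D" using gb by simp
    also have "\<dots> \<le> N" using gb by (intro mult_le_mono1) auto
    finally have q: "(g * D + b) mod N = g * D + b" by simp
    have gd: "(g * D + b) mod D = b" "(g * D + b) div D = g" using gb D_pos by auto
    show ?thesis
      unfolding block_sum gd coeff_def q by (intro sum.cong refl) (auto simp: padded_def)
  qed
  then show ?thesis unfolding sketch_energy_def sum_lessThan_mult by simp
qed

text \<open>On nonnegative numbers truncation at 1 is subadditive, so the cap moves outside the sum.
  Dividing by \<open>B\<close> instead of the block size only lowers each term.\<close>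

lemma bias_energy_lower:
  "min (sketch_energy K D B (padded \<mu>) (h r) / B) 1 / 9 \<le> (\<Sum>q<N. (bias r \<mu> q)\<^sup>2)"
proof -
  let ?z = "\<lambda>q. (\<Sum>i\<in>block q. coeff r q i * \<mu> i)"
  have min_sum: "min (\<Sum>q\<in>A. f q) 1 \<le> (\<Sum>q\<in>A. min (f q) (1 :: real))"
    if "finite A" "\<And>q. f q \<ge> 0" for A :: "nat set" and f
    using that(1)
  proof (induction A)
    case (insert x F)
    have "0 \<le> sum f F" using that(2) by (intro sum_nonneg)
    then have "min (f x + sum f F) 1 \<le> min (f x) 1 + min (sum f F) 1"
      using that(2)[of x] by (auto simp: min_def)
    then show ?case using insert by simp
  qed simp
  have "min (sketch_energy K D B (padded \<mu>) (h r) / B) 1 = min (\<Sum>q<N. (?z q)\<^sup>2 / B) 1"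
    by (simp add: sketch_energy_eq[symmetric] sum_divide_distrib)
  also have "\<dots> \<le> (\<Sum>q<N. min ((?z q)\<^sup>2 / B) 1)" by (intro min_sum) auto
  also have "\<dots> \<le> (\<Sum>q<N. 9 * (bias r \<mu> q)\<^sup>2)"
  proof (intro sum_mono)
    fix q
    have c: "0 < card (block q)" using finite_block block_nonempty by (simp add: card_gt_0_iff)
    have "(?z q)\<^sup>2 / B \<le> (?z q)\<^sup>2 / card (block q)"
      using c card_block_le[of q] by (intro divide_left_mono) auto
    then have "min ((?z q)\<^sup>2 / B) 1 \<le> min ((?z q / sqrt (card (block q)))\<^sup>2) 1"
      using c by (simp add: power_divide min.coboundedI1 min_le_iff_disj)
    then show "min ((?z q)\<^sup>2 / B) 1 \<le> 9 * (bias r \<mu> q)\<^sup>2"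
      using sign_bias_square_lower[of "?z q / sqrt (card (block q))"] by (simp add: bias_def)
  qed
  finally show ?thesis by (simp add: sum_distrib_left[symmetric])
qed

section \<open>Error of the protocol\<close>

lemma seed_prob:
  "measure (PiM {..<n} (private_seed sketch_test) \<Otimes>\<^sub>M PiM {..<n} (\<lambda>_. gaussian d \<mu>))
      {p \<in> space (PiM {..<n} (private_seed sketch_test) \<Otimes>\<^sub>M PiM {..<n} (\<lambda>_. gaussian d \<mu>)).
        test sketch_test (messages n sketch_test (r, p)) = b}
    = measure (PiM {..<n} (\<lambda>_. gaussian d \<mu>)) {x \<in> space (PiM {..<n} (\<lambda>_. gaussian d \<mu>)).
        ((real m)\<^sup>2 * \<kappa> / 2 \<le> paired_statistic N m (\<lambda>p. sample_sign r p x)) = b}"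
    (is "measure (?R \<Otimes>\<^sub>M ?X) ?E = measure ?X ?E'")
proof -
  interpret R: prob_space ?R
    using is_protocol_sketch_test by (auto simp: is_protocol_def intro!: prob_space_PiM)
  interpret X: prob_space ?X by (intro prob_space_PiM prob_space_gaussian)
  interpret sign_array ?X N m "sample_sign r" "bias r \<mu>" by (rule sign_array_sample_sign)
  have E': "?E' \<in> sets ?X" using measurable_statistic by (cases b) auto
  \<comment> \<open>For a fixed public string the messages do not depend on the private seeds, so
    the event is a rectangle over the whole seed space.\<close>
  have "?E = space ?R \<times> ?E'"
    by (auto simp: space_pair_measure test_messages)
  then have "emeasure (?R \<Otimes>\<^sub>M ?X) ?E = emeasure ?X ?E'"
    using E' X.emeasure_pair_measure_Times[of "space ?R" ?R ?E'] by (simp add: R.emeasure_space_1)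
  then show ?thesis by (simp add: measure_def)
qed

text \<open>With mean zero all biases vanish for every public string, so no seed is
  exceptional.\<close>

lemma false_alarm: "output_prob n s sketch_test (gaussian d (\<lambda>_. 0)) True \<le> 1 / 10"
proof -
  let ?X = "PiM {..<n} (\<lambda>_. gaussian d (\<lambda>_. 0))"
  have "measure ?X {x \<in> space ?X. (real m)\<^sup>2 * \<kappa> / 2 \<le> paired_statistic N m (\<lambda>p. sample_sign r p x)}
      \<le> 1 / 10" for r
  proof -
    interpret sign_array ?X N m "sample_sign r" "bias r (\<lambda>_. 0)" by (rule sign_array_sample_sign)
    have "energy = 0" by (simp add: energy_def bias_def)
    then show ?thesis using separation N_pos kappa_pos by (intro false_alarm_prob) auto
  qed
  then have "output_prob n s sketch_test (gaussian d (\<lambda>_. 0)) True \<le> (\<Sum>r :: bool list | length r = s. 1 / 10) / 2 ^ s"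
    unfolding output_prob_eq_average[OF is_protocol_sketch_test sets_gaussian prob_space_gaussian] seed_prob
    by (intro divide_right_mono sum_mono) auto
  then show ?thesis by simp
qed

text \<open>At most 1 / 20 of the public strings lose too much energy; on each of the others the
  test misses with probability at most 1 / 20.\<close>

lemma missed_detection:
  assumes \<mu>: "\<epsilon> \<le> L2_set \<mu> {..<d}"
  shows "output_prob n s sketch_test (gaussian d \<mu>) False \<le> 1 / 10"
proof -
  let ?X = "PiM {..<n} (\<lambda>_. gaussian d \<mu>)"
  let ?p = "\<lambda>r. measure ?X {x \<in> space ?X.
    ((real m)\<^sup>2 * \<kappa> / 2 \<le> paired_statistic N m (\<lambda>p. sample_sign r p x)) = False}"
  define V where "V = (\<Sum>i<d. (\<mu> i)\<^sup>2)"
  let ?R = "{r :: bool list. length r = s}"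
  let ?bad = "{r \<in> ?R. sketch_energy K D B (padded \<mu>) (h r) < K * V / 2}"
  have "\<epsilon>\<^sup>2 \<le> (L2_set \<mu> {..<d})\<^sup>2" using \<mu> eps by (intro power_mono) auto
  also have "\<dots> = V" unfolding L2_set_def V_def by (intro real_sqrt_pow2 sum_nonneg) auto
  finally have V: "\<epsilon>\<^sup>2 \<le> V" .
  then have V0: "V > 0" using eps by (meson less_le_trans zero_less_power)
  have "card ?bad \<le> 8 / K * card ?R"
    by (rule card_low_sketch_energy)
       (use h orth V0 K in \<open>auto simp: padded_norm V_def\<close>)
  then have bad: "real (card ?bad) \<le> 2 ^ s / 20" using K by simp
  have good: "?p r \<le> 1 / 20" if "r \<notin> ?bad" "r \<in> ?R" for r
  proof -
    interpret sign_array ?X N m "sample_sign r" "bias r \<mu>" by (rule sign_array_sample_sign)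
    have "\<epsilon>\<^sup>2 \<le> K * V / 2" using V V0 K by simp
    also have "\<dots> \<le> sketch_energy K D B (padded \<mu>) (h r)" using that by simp
    finally have "\<epsilon>\<^sup>2 / B \<le> sketch_energy K D B (padded \<mu>) (h r) / B" by (intro divide_right_mono) auto
    moreover have "\<epsilon>\<^sup>2 / B \<le> 1"
    proof -
      have "\<epsilon>\<^sup>2 \<le> 1" using eps by (simp add: power_le_one)
      also have "1 \<le> real B" using B by simp
      finally show ?thesis using B by (simp add: divide_le_eq)
    qed
    ultimately have "\<kappa> \<le> min (sketch_energy K D B (padded \<mu>) (h r) / B) 1 / 9" by simp
    also have "\<dots> \<le> energy" unfolding energy_def by (rule bias_energy_lower)
    finally show ?thesis
      using missed_detection_prob[of \<kappa>] separation N_pos kappa_pos by (simp add: not_le)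
  qed
  have le1: "?p r \<le> 1" for r
    by (intro prob_space.prob_le_1 prob_space_PiM prob_space_gaussian)
  have "(\<Sum>r\<in>?R. ?p r) \<le> (\<Sum>r\<in>?R. (if r \<in> ?bad then 1 else 0) + 1 / 20)"
  proof (intro sum_mono)
    fix r assume "r \<in> ?R"
    then show "?p r \<le> (if r \<in> ?bad then 1 else 0) + 1 / 20"
      using good[of r] le1[of r] by (cases "r \<in> ?bad") (auto simp del: mem_Collect_eq)
  qed
  also have "\<dots> = card ?bad + 2 ^ s / 20"
    by (simp add: sum.distrib sum.If_cases Int_def conj_commute)
  also have "\<dots> \<le> 2 ^ s / 10" using bad by simp
  finally show ?thesis
    unfolding output_prob_eq_average[OF is_protocol_sketch_test sets_gaussian prob_space_gaussian] seed_prob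
    by (simp add: divide_le_eq)
qed

lemma test_error_sketch_test: "test_error d \<epsilon> n s sketch_test \<le> 1 / 10"
  unfolding test_error_def
proof (intro max.boundedI cSUP_least)
  show "null_hyp d \<noteq> {}" by (simp add: null_hyp_def)
  \<comment> \<open>Bounding a supremum by \<open>cSUP_least\<close> needs a nonempty set. The
    constant mean vector \<open>\<epsilon>\<close> is a witness, as its norm is
    \<open>sqrt d * \<epsilon>\<close>.\<close>
  have "\<epsilon> \<le> sqrt (d * \<epsilon>\<^sup>2)" using d eps by (intro real_le_rsqrt) simp
  then have "\<epsilon> \<le> L2_set (\<lambda>_. \<epsilon>) {..<d}" by (simp add: L2_set_def)
  then show "alt_hyp d \<epsilon> \<noteq> {}" unfolding alt_hyp_def by blast
next
  fix G assume "G \<in> null_hyp d"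
  then have "G = gaussian d (\<lambda>_. 0)" by (simp add: null_hyp_def)
  then show "output_prob n s sketch_test G True \<le> 1 / 10" using false_alarm by simp
next
  fix G assume "G \<in> alt_hyp d \<epsilon>"
  then obtain \<mu> where "G = gaussian d \<mu>" "\<epsilon> \<le> L2_set \<mu> {..<d}" by (auto simp: alt_hyp_def)
  then show "output_prob n s sketch_test G False \<le> 1 / 10" using missed_detection by simp
qed

end

section \<open>Choice of parameters\<close>

text \<open>With \<open>x = d / L\<close> one has \<open>x \<ge> 2\<close> and
  \<open>x \<ge> B\<close>, so \<open>160 * B \<le> x ^ 8 * x\<close>, whose cube is
  \<open>x ^ 27\<close>. The constant is 54 = 2 * 27 because
  \<open>ln 2 \<ge> 1 / 2\<close>.\<close>

lemma seed_length_sufficient: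
  fixes d B L s :: nat
  assumes s: "54 * ln (real d / real L) \<le> s" and L: "L > 0" and B: "B \<ge> 2" "B * L \<le> d"
  shows "(160 * B) ^ 3 \<le> 2 ^ s"
proof -
  define x where "x = real d / real L"
  have "real B * real L \<le> d" using B(2) by (metis of_nat_le_iff of_nat_mult)
  then have Bx: "real B \<le> x" using L by (simp add: x_def le_divide_eq)
  then have x2: "2 \<le> x" using B(1) by linarith
  have ln2: "1 / 2 \<le> ln (2 :: real)" using ln_add_one_self_le_self2[of "-1/2"] by (simp add: ln_div)
  have "27 * ln x = 54 * ln x * (1 / 2)" by simp
  also have "\<dots> \<le> 54 * ln x * ln 2" using x2 ln2 by (intro mult_left_mono) auto
  also have "\<dots> \<le> s * ln 2" using s ln2 by (intro mult_right_mono) (auto simp: x_def)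
  finally have "ln (x ^ 27) \<le> ln (2 ^ s)" using x2 by (simp add: ln_realpow)
  then have le: "x ^ 27 \<le> 2 ^ s" using x2 by simp
  have "160 \<le> (2 :: real) ^ 8" by simp
  also have "\<dots> \<le> x ^ 8" using x2 by (intro power_mono) auto
  finally have "160 * real B \<le> x ^ 8 * x" using Bx x2 by (intro mult_mono) auto
  then have "(160 * real B) ^ 3 \<le> (x ^ 9) ^ 3" by (intro power_mono) (auto simp: eval_nat_numeral)
  also have "\<dots> = x ^ 27" by (simp add: power_mult[symmetric])
  finally have "(160 * real B) ^ 3 \<le> 2 ^ s" using le by linarith
  then have "real ((160 * B) ^ 3) \<le> real (2 ^ s)" by simp
  then show ?thesis by (simp only: of_nat_le_iff)
qed

text \<open>For \<open>B = 1\<close> there may be no public bits at all, and constant signs suffice.\<close>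

lemma exists_block_signs:
  assumes "54 * ln (real d / real L) \<le> s" "L > 0" "B * L \<le> d" "B \<ge> 1"
  shows "\<exists>h :: bool list \<Rightarrow> nat \<Rightarrow> real. (\<forall>r x. h r x = 1 \<or> h r x = -1) \<and>
    (\<forall>g f e g' f' e'. g < 160 \<longrightarrow> f < B \<longrightarrow> e < f \<longrightarrow> g' < 160 \<longrightarrow> f' < B \<longrightarrow> e' < f' \<longrightarrow>
      (\<Sum>r | length r = s. (h r (g * B + e) * h r (g * B + f)) * (h r (g' * B + e') * h r (g' * B + f')))
        = (if g = g' \<and> e = e' \<and> f = f' then 2 ^ s else 0))"
proof (cases "B = 1")
  case True
  then show ?thesis by (intro exI[of _ "\<lambda>_ _. 1"]) auto
next
  case False
  then have B: "B \<ge> 2" using assms by linarith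
  obtain h :: "bool list \<Rightarrow> nat \<Rightarrow> real" where
    h: "(\<forall>r x. h r x = 1 \<or> h r x = -1) \<and> (\<forall>y<160 * B. \<forall>x<y. \<forall>y'<160 * B. \<forall>x'<y'.
      (\<Sum>r | length r = s. (h r x * h r y) * (h r x' * h r y')) = (if x = x' \<and> y = y' then 2 ^ s else 0))"
    by (rule exE[OF exists_pairwise_orthonormal_signs[OF seed_length_sufficient[OF assms(1,2) B assms(3)]]])
  have orth: "(\<Sum>r | length r = s. (h r x * h r y) * (h r x' * h r y')) = (if x = x' \<and> y = y' then 2 ^ s else 0)"
    if "y < 160 * B" "x < y" "y' < 160 * B" "x' < y'" for x y x' y'
    by (rule conjunct2[OF h, rule_format, OF that])
  have lt: "g * B + f < 160 * B" if "g < 160" "f < B" for g f :: nat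
  proof -
    have "g * B + f < Suc g * B" using that by simp
    also have "\<dots> \<le> 160 * B" using that by (intro mult_le_mono1) simp
    finally show ?thesis .
  qed
  have inj: "g = g' \<and> f = f'" if "g * B + f = g' * B + f'" "f < B" "f' < B" for g f g' f' :: nat
  proof -
    have "(g * B + f) mod B = (g' * B + f') mod B" "(g * B + f) div B = (g' * B + f') div B"
      using that(1) by simp_all
    then show ?thesis using that(2,3) by simp
  qed
  show ?thesis
  proof (intro exI[of _ h] conjI conjunct1[OF h] allI impI)
    fix g f e g' f' e' :: nat assume a: "g < 160" "f < B" "e < f" "g' < 160" "f' < B" "e' < f'"
    then have "g * B + e = g' * B + e' \<and> g * B + f = g' * B + f' \<longleftrightarrow> g = g' \<and> e = e' \<and> f = f'"
      using inj[of g e g' e'] inj[of g f g' f'] by auto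
    then show "(\<Sum>r | length r = s. (h r (g * B + e) * h r (g * B + f)) * (h r (g' * B + e') * h r (g' * B + f')))
        = (if g = g' \<and> e = e' \<and> f = f' then 2 ^ s else 0)"
      using orth[OF lt[OF a(1,2)] _ lt[OF a(4,5)], of "g * B + e" "g' * B + e'"] a by simp
  qed
qed

text \<open>Since \<open>D \<le> 2 * L\<close>, the number \<open>m\<close> of rounds is of order
  \<open>l1 / L\<close>. The budget together with \<open>B * L \<le> d\<close> then makes
  \<open>m * \<epsilon>\<^sup>2\<close> a large multiple of \<open>B * sqrt L\<close>.\<close>

lemma budget_separation:
  fixes d L B D l1 m :: nat and \<epsilon> :: real
  assumes budget: "10 ^ 8 * (real d / \<epsilon>\<^sup>2) \<le> real l1 / sqrt (real L)"
    and eps: "0 < \<epsilon>" "\<epsilon> \<le> 1" and L: "L > 0" and B: "B \<ge> 1" "B * L \<le> d" and D: "0 < D" "D \<le> 2 * L"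
    and m: "m = l1 div (2 * (160 * D))"
  shows "400 * sqrt (real (160 * D)) \<le> m * (\<epsilon>\<^sup>2 / (9 * B))"
proof -
  let ?N = "real (160 * D)"
  have sL: "sqrt L \<ge> 1" using L by simp
  have e2: "0 < \<epsilon>\<^sup>2" "\<epsilon>\<^sup>2 \<le> 1" using eps by (auto simp: power_le_one)
  have BL: "real B * real L \<le> d" using B(2) by (metis of_nat_le_iff of_nat_mult)
  then have Ld: "real L \<le> d" using B(1) mult_right_mono[of 1 "real B" "real L"] by simp
  have N: "?N \<le> 320 * real L" using D(2) by simp
  have l1: "10 ^ 8 * (real d * sqrt L) \<le> real l1 * \<epsilon>\<^sup>2"
    using budget e2 sL by (simp add: field_simps)
  have "4 * ?N \<le> 10 ^ 8 * (real d * 1)" using N Ld by simp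
  also have "\<dots> \<le> 10 ^ 8 * (real d * sqrt L)" using sL by (intro mult_left_mono) auto
  also have "\<dots> \<le> real l1 * 1" using l1 e2 by (meson mult_left_mono of_nat_0_le_iff order_trans)
  finally have big: "4 * ?N \<le> l1" by simp
  have N0: "?N > 0" using D by simp
  have "l1 < 2 * (160 * D) + l1 div (2 * (160 * D)) * (2 * (160 * D))"
    using D dividend_less_div_times[of "2 * (160 * D)" l1] by simp
  then have "l1 < (m + 1) * (2 * (160 * D))" unfolding m by simp
  then have "real l1 < real ((m + 1) * (2 * (160 * D)))" by (simp only: of_nat_less_iff)
  then have "real l1 < (m + 1) * (2 * ?N)" by (simp only: of_nat_mult of_nat_numeral)
  then have "real l1 / (2 * ?N) < m + 1" using N0 by (subst divide_less_eq) simp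
  moreover have "real l1 / (4 * ?N) \<ge> 1" using big N0 by simp
  moreover have "real l1 / (2 * ?N) = 2 * (real l1 / (4 * ?N))" by simp
  \<comment> \<open>Rounding \<open>m\<close> down costs at most a factor 2, because the unrounded
    quotient is at least 2.\<close>
  ultimately have "real l1 / (4 * ?N) \<le> m" by linarith
  moreover have "real l1 / (1280 * L) \<le> real l1 / (4 * ?N)"
    using N N0 by (intro divide_left_mono) auto
  ultimately have "real l1 / (1280 * L) \<le> m" by linarith
  then have ml: "real l1 \<le> m * (1280 * L)" using L by (simp add: divide_le_eq)
  have "10 ^ 8 * ((real B * real L) * sqrt L) \<le> 10 ^ 8 * (real d * sqrt L)"
    using BL by (intro mult_left_mono mult_right_mono) auto
  also have "\<dots> \<le> m * (1280 * L) * \<epsilon>\<^sup>2"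
    using l1 ml e2 by (meson mult_right_mono order_trans order_less_imp_le)
  finally have "L * (10 ^ 8 * (B * sqrt L)) \<le> L * (1280 * (m * \<epsilon>\<^sup>2))" by (simp add: mult_ac)
  then have "10 ^ 8 * (B * sqrt L) \<le> 1280 * (m * \<epsilon>\<^sup>2)" using L by simp
  then have "78125 * (B * sqrt L) \<le> m * \<epsilon>\<^sup>2" by simp
  moreover have "0 \<le> B * sqrt L" by simp
  \<comment> \<open>64800 = 400 * 18 * 9, where 18 bounds the square root of 320 = 2 * 160.\<close>
  ultimately have "64800 * (B * sqrt L) \<le> m * \<epsilon>\<^sup>2" by linarith
  then have "7200 * sqrt L * (9 * B) \<le> m * \<epsilon>\<^sup>2" by (simp add: mult_ac)
  then have main: "7200 * sqrt L \<le> m * (\<epsilon>\<^sup>2 / (9 * B))" using B(1) by (simp add: le_divide_eq)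
  have "sqrt ?N \<le> sqrt (18\<^sup>2 * real L)" using N by simp
  also have "\<dots> = 18 * sqrt L" by (simp only: real_sqrt_mult real_sqrt_power) simp
  finally show ?thesis using main by simp
qed

theorem theorem3:
  shows "\<exists>C c :: real. C > 0 \<and> c > 0 \<and>
    (\<forall>(d::nat) (\<epsilon>::real) (n::nat) (l :: nat \<Rightarrow> nat) (s::nat).
       d \<ge> 1 \<longrightarrow> 0 < \<epsilon> \<longrightarrow> \<epsilon> \<le> 1 \<longrightarrow> n \<ge> 1 \<longrightarrow>
       linf_norm n l \<le> d \<longrightarrow>
       real s \<ge> c * ln (real d / real (linf_norm n l)) \<longrightarrow>
       real (l1_norm n l) / sqrt (real (linf_norm n l)) \<ge> C * (real d / \<epsilon>\<^sup>2) \<longrightarrow>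
       (\<exists>P. is_protocol d n s l P \<and> test_error d \<epsilon> n s P \<le> 1 / 10))"
proof (rule exI[of _ "10 ^ 8"], rule exI[of _ 54], intro conjI allI impI)
  fix d n s :: nat and \<epsilon> :: real and l :: "nat \<Rightarrow> nat"
  assume d: "d \<ge> 1" and eps: "0 < \<epsilon>" "\<epsilon> \<le> 1" and n: "n \<ge> 1" and Ld: "linf_norm n l \<le> d"
    and s: "54 * ln (real d / real (linf_norm n l)) \<le> real s"
    and budget: "10 ^ 8 * (real d / \<epsilon>\<^sup>2) \<le> real (l1_norm n l) / sqrt (real (linf_norm n l))"
  define L where "L = linf_norm n l"
  \<comment> \<open>Rounding down gives \<open>B * L \<le> d\<close>, as the seed length and the
    budget require, and also \<open>d < 2 * B * L\<close>, hence
    \<open>D \<le> 2 * L\<close>.\<close>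
  define B where "B = d div L"
  define D where "D = (d - 1) div B + 1"
  define m where "m = l1_norm n l div (2 * (160 * D))"
  have "0 < 10 ^ 8 * (real d / \<epsilon>\<^sup>2)" using d eps by simp
  \<comment> \<open>If the maximum were 0, the right-hand side of \<open>budget\<close> would be a
    division by zero, which has value 0.\<close>
  then have L: "L > 0" using budget unfolding L_def by (cases "linf_norm n l = 0") auto
  have B: "B \<ge> 1" using Ld L by (simp add: B_def L_def div_greater_zero_iff Suc_le_eq)
  have BL: "B * L \<le> d" unfolding B_def by (rule div_times_less_eq_dividend)
  have "d < (B + 1) * L" unfolding B_def using dividend_less_div_times[OF L, of d] by simp
  also have "\<dots> \<le> (2 * B) * L" using B by (intro mult_le_mono1) simp
  finally have "(d - 1) div B < 2 * L"
    by (intro less_mult_imp_div_less) (simp add: mult_ac)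
  then have D: "0 < D" "D \<le> 2 * L" by (simp_all add: D_def)
  \<comment> \<open>The blocks cover all \<open>d \<ge> B * L\<close> coordinates, so there are at
    least \<open>L\<close> of them and even the longest message can use a different block for each
    bit.\<close>
  have "d - 1 < D * B" using dividend_less_div_times[of B "d - 1"] B by (simp add: D_def)
  then have "B * L \<le> D * B" using BL d by linarith
  then have "L * B \<le> D * B" by (simp only: mult.commute)
  then have LD: "L \<le> D" using B by simp
  have l: "l k \<le> D" if "k < n" for k
  proof -
    have "l k \<le> L" unfolding L_def linf_norm_def using that by (intro Max_ge) auto
    then show ?thesis using LD by simp
  qed
  obtain h :: "bool list \<Rightarrow> nat \<Rightarrow> real" where h: "\<And>r x. h r x = 1 \<or> h r x = -1"
      "\<And>g f e g' f' e'. \<lbrakk>g < 160; f < B; e < f; g' < 160; f' < B; e' < f'\<rbrakk> \<Longrightarrow>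
      (\<Sum>r | length r = s. (h r (g * B + e) * h r (g * B + f)) * (h r (g' * B + e') * h r (g' * B + f')))
        = (if g = g' \<and> e = e' \<and> f = f' then 2 ^ s else 0)"
    using exists_block_signs[OF s[folded L_def] L BL B] by blast
  have rounds: "2 * m * (160 * D) \<le> l1_norm n l"
    unfolding m_def using div_times_less_eq_dividend[of "l1_norm n l" "2 * (160 * D)"] by (simp add: mult_ac)
  have separation: "400 * sqrt (real (160 * D)) \<le> real m * (\<epsilon>\<^sup>2 / real (9 * B))"
    using budget_separation[OF budget[folded L_def] eps L B BL D m_def] by simp
  interpret sketch_protocol d n s l \<epsilon> 160 B D m h
    by (rule sketch_protocol.intro[OF d B D_def l h(1) h(2) refl rounds eps separation])
  show "\<exists>P. is_protocol d n s l P \<and> test_error d \<epsilon> n s P \<le> 1 / 10"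
    using is_protocol_sketch_test test_error_sketch_test by blast
qed simp_all

end
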